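(* Let $v^*\in\Delta$ be a linearly stable equilibrium. Then $\mathbb P(v_n\to v^* )>0$.
   Context: Let $N\ge2$, $E=\{1,\dots,N\}$, $\alpha>1$, and let $A=(A_{i,j})_{i,j\le N}$ be a symmetric matrix with nonnegative entries, $A_{i,j}>0$ for $i\ne j$, and $\sum_j A_{i,j}$ independent of $i$. Let $(X_n)_{n\ge0}$ be a process on $E$ with arbitrary initial state such that, with $\mathcal F_n=\sigma(X_k;k\le n)$ and $Z_n(j)=\sum_{\ell=0}^n\mathbf 1_{\{X_\ell=j\}}$, $\mathbb P(X_{n+1}=j\mid\mathcal F_n)=\dfrac{A_{X_n,j}(1+Z_n(j))^\alpha}{\sum_{k\le N}A_{X_n,k}(1+Z_n(k))^\alpha}$, and let $v_n(i)=Z_n(i)/(n+1)$. Let $\Delta=\{v\in\mathbb R_+^N:\ \sum_i v_i=1,\ v_i\le 3/4 \text{ whenever } A_{i,i}=0\}$. For $v$ with nonnegative coordinates let $v^\alpha=(v_i^\alpha)_i$, $H(v)=\sum_{i,j}A_{i,j}v_i^\alpha v_j^\alpha$, $\pi_i(v)=v_i^\alpha(Av^\alpha)_i/H(v)$, and on $\Delta$ let $F(v)=-v+\pi(v)$. An equilibrium is $v\in\Delta$ with $F(v)=0$; with $DF(v)$ the differential at $v$ of $v\mapsto -v+\pi(v)$ acting on $\{x:\sum_ix_i=0\}$, an equilibrium is linearly stable if all eigenvalues of $DF(v)$ have negative real parts. *)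

theory Defs
  imports "HOL-Analysis.Analysis" "HOL-Probability.Probability"
begin

definition admissible_matrix :: "real^'n^'n \<Rightarrow> bool" where
  "admissible_matrix A \<longleftrightarrow>
     transpose A = A \<and> (\<forall>i j. 0 \<le> A$i$j) \<and> (\<forall>i j. i \<noteq> j \<longrightarrow> 0 < A$i$j) \<and>
     (\<exists>c. \<forall>i. (\<Sum>j\<in>UNIV. A$i$j) = c)"

definition visits :: "(nat \<Rightarrow> 'n) \<Rightarrow> nat \<Rightarrow> 'n \<Rightarrow> nat" where
  "visits h n j = card {l. l \<le> n \<and> h l = j}"

definition vrrw_trans :: "real^'n^'n \<Rightarrow> real \<Rightarrow> (nat \<Rightarrow> 'n) \<Rightarrow> nat \<Rightarrow> 'n \<Rightarrow> real" where
  "vrrw_trans A \<alpha> h n j =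
     A$(h n)$j * (1 + real (visits h n j)) powr \<alpha> /
     (\<Sum>k\<in>UNIV. A$(h n)$k * (1 + real (visits h n k)) powr \<alpha>)"

text \<open>X is the vertex-reinforced walk on probability space M, started at x0:
  the conditional law of X_{n+1} given F_n = sigma(X_0..X_n) (a finite sigma-algebra
  generated by the atoms {X_0 = h 0, ..., X_n = h n}) is given by vrrw_trans.\<close>
definition is_vrrw :: "'w measure \<Rightarrow> real^'n^'n \<Rightarrow> real \<Rightarrow> 'n \<Rightarrow> (nat \<Rightarrow> 'w \<Rightarrow> 'n) \<Rightarrow> bool" where
  "is_vrrw M A \<alpha> x0 X \<longleftrightarrow>
     prob_space M \<and>
     (\<forall>n. X n \<in> measurable M (count_space UNIV)) \<and>
     (\<forall>\<omega>\<in>space M. X 0 \<omega> = x0) \<and>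
     (\<forall>n h j. measure M {\<omega>\<in>space M. (\<forall>k\<le>n. X k \<omega> = h k) \<and> X (Suc n) \<omega> = j}
              = vrrw_trans A \<alpha> h n j * measure M {\<omega>\<in>space M. \<forall>k\<le>n. X k \<omega> = h k})"

definition occ :: "(nat \<Rightarrow> 'w \<Rightarrow> 'n) \<Rightarrow> nat \<Rightarrow> 'w \<Rightarrow> real^'n" where
  "occ X n \<omega> = (\<chi> i. real (visits (\<lambda>l. X l \<omega>) n i) / real (n + 1))"

definition Delta :: "real^'n^'n \<Rightarrow> (real^'n) set" where
  "Delta A = {v. (\<forall>i. 0 \<le> v$i) \<and> (\<Sum>i\<in>UNIV. v$i) = 1 \<and> (\<forall>i. A$i$i = 0 \<longrightarrow> v$i \<le> 3/4)}"

definition Hfun :: "real^'n^'n \<Rightarrow> real \<Rightarrow> real^'n \<Rightarrow> real" where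
  "Hfun A \<alpha> v = (\<Sum>i\<in>UNIV. \<Sum>j\<in>UNIV. A$i$j * v$i powr \<alpha> * v$j powr \<alpha>)"

definition pifun :: "real^'n^'n \<Rightarrow> real \<Rightarrow> real^'n \<Rightarrow> real^'n" where
  "pifun A \<alpha> v = (\<chi> i. v$i powr \<alpha> * (\<Sum>j\<in>UNIV. A$i$j * v$j powr \<alpha>) / Hfun A \<alpha> v)"

definition Ffun :: "real^'n^'n \<Rightarrow> real \<Rightarrow> real^'n \<Rightarrow> real^'n" where
  "Ffun A \<alpha> v = - v + pifun A \<alpha> v"

definition equilibrium :: "real^'n^'n \<Rightarrow> real \<Rightarrow> real^'n \<Rightarrow> bool" where
  "equilibrium A \<alpha> v \<longleftrightarrow> v \<in> Delta A \<and> Ffun A \<alpha> v = 0"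

definition tangent_space :: "(real^'n) set" where
  "tangent_space = {x. (\<Sum>i\<in>UNIV. x$i) = 0}"

text \<open>Complex eigenvalue a + i b of a real linear map L restricted to an invariant subspace T:
  there is a nonzero complex vector x + i y with x, y in T and L(x + i y) = (a + i b)(x + i y).\<close>
definition is_eigenvalue_on :: "(real^'n \<Rightarrow> real^'n) \<Rightarrow> (real^'n) set \<Rightarrow> complex \<Rightarrow> bool" where
  "is_eigenvalue_on L T mu \<longleftrightarrow>
     (\<exists>x y. x \<in> T \<and> y \<in> T \<and> (x \<noteq> 0 \<or> y \<noteq> 0) \<and>
        L x = Re mu *\<^sub>R x - Im mu *\<^sub>R y \<and> L y = Im mu *\<^sub>R x + Re mu *\<^sub>R y)"

text \<open>Linear stability: DF(v) = -id + D pi(v), where D pi(v) is the differential of pi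
  (defined on the nonnegative orthant) at v, acting on the tangent space {sum x = 0};
  all its eigenvalues have negative real part.\<close>
definition linearly_stable :: "real^'n^'n \<Rightarrow> real \<Rightarrow> real^'n \<Rightarrow> bool" where
  "linearly_stable A \<alpha> v \<longleftrightarrow> equilibrium A \<alpha> v \<and>
     (\<exists>D. (pifun A \<alpha> has_derivative D) (at v within {x. \<forall>i. 0 \<le> x$i}) \<and>
          (\<forall>mu. is_eigenvalue_on (\<lambda>x. - x + D x) tangent_space mu \<longrightarrow> Re mu < 0))"

end

theory Submission
  imports Defs
begin

text \<open>The smoothed frequencies \<open>w n = (1 + visits) / (n + 1 + N)\<close> form, together with the current state, a
  Markov chain: the transition probabilities depend on \<open>w n\<close> only. Their kernel is reversible for \<open>pifun w\<close>
  and has an inverse (Green's matrix) that is Lipschitz in \<open>w\<close>, so the noise \<open>X (n+1) - pifun (w n)\<close>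
  can be absorbed by the usual Poisson-equation corrector.

  Reversibility also makes the differential of \<open>pifun\<close> at an equilibrium self-adjoint for an explicit weighted
  inner product. Linear stability is then a bound on a Rayleigh quotient, and the weighted squared distance to
  \<open>v*\<close> is a Lyapunov function. After adding the corrector and a multiple of the step size it is
  a supermartingale near \<open>v*\<close> with drift proportional to its value over \<open>n\<close>. A maximal inequality keeps the
  walk near \<open>v*\<close> with positive probability, divergence of the harmonic series makes the
  expectation small at some late time, and the maximal inequality restarted there gives convergence.

  It remains to come close to \<open>v*\<close> at a late time with positive probability, which follows from a single
  admissible path whose frequencies converge to \<open>v*\<close>.\<close>

subsection \<open>Local Lipschitz functions\<close>

text \<open>The equilibrium may lie on the boundary of the simplex, so all regularity is taken
  relative to the orthant: \<alpha> > 1 keeps powers differentiable and locally Lipschitz down to 0,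
  and the differential of \<open>pifun\<close> is one-sided there. The state changes at unit speed
  while the frequencies move by O(1/n), so \<open>Ffun\<close> describes the motion only after
  averaging over the chain with frozen frequencies. The corrector performs this averaging at the
  price of errors of the order of the squared step size. Since consecutive step sizes satisfy s_n -
  s_(n+1) = s_n s_(n+1), a multiple of s_n telescopes and pays for them. The differential is
  self-adjoint on the whole space and has its range in the tangent space, so a maximiser of the
  Rayleigh quotient can be compared with the eigenvalue condition, which speaks of tangent vectors
  only. The drift estimate holds only near the equilibrium, so the process is stopped on leaving a
  neighbourhood. As the state space is finite, adapted quantities are functions of path prefixes and
  expectations are finite sums over cylinders.\<close>

definition lip_at :: "('a::real_normed_vector) set \<Rightarrow> 'a \<Rightarrow> ('a \<Rightarrow> real) \<Rightarrow> bool" where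
  "lip_at S a f \<longleftrightarrow> (\<exists>L. \<forall>\<^sub>F r in at_right 0. L-lipschitz_on (S \<inter> cball a r) f)"

lemma lip_atI:
  assumes "0 < r" "\<And>x y. x \<in> S \<Longrightarrow> y \<in> S \<Longrightarrow> norm (x - a) \<le> r \<Longrightarrow> norm (y - a) \<le> r \<Longrightarrow>
    \<bar>f x - f y\<bar> \<le> L * norm (x - y)"
  shows "lip_at S a f"
proof -
  have "(max L 0)-lipschitz_on (S \<inter> cball a r') f" if "0 < r'" "r' < r" for r'
  proof (rule lipschitz_onI)
    fix x y assume "x \<in> S \<inter> cball a r'" "y \<in> S \<inter> cball a r'"
    then have "\<bar>f x - f y\<bar> \<le> L * norm (x - y)"
      using that by (intro assms(2)) (auto simp: dist_norm norm_minus_commute)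
    also have "\<dots> \<le> max L 0 * norm (x - y)" by (intro mult_right_mono) auto
    finally show "dist (f x) (f y) \<le> max L 0 * dist x y" by (simp add: dist_norm)
  qed simp
  then have "\<forall>\<^sub>F r' in at_right 0. (max L 0)-lipschitz_on (S \<inter> cball a r') f"
    unfolding eventually_at_right_field using assms(1) by blast
  then show ?thesis unfolding lip_at_def by blast
qed

text \<open>Being eventual in the radius, the estimate lets finitely many functions share one radius
  through \<open>eventually_elim\<close>, with no explicit minimum of radii.\<close>

lemma lip_atE:
  assumes "lip_at S a f"
  obtains L where "0 \<le> L" "\<forall>\<^sub>F r in at_right 0. \<forall>x\<in>S. \<forall>y\<in>S. norm (x - a) \<le> r \<longrightarrow> norm (y - a) \<le> r \<longrightarrow>
    \<bar>f x - f y\<bar> \<le> L * norm (x - y)"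
proof -
  from assms obtain L where L: "\<forall>\<^sub>F r in at_right 0. L-lipschitz_on (S \<inter> cball a r) f"
    unfolding lip_at_def by blast
  then have "\<exists>r. L-lipschitz_on (S \<inter> cball a r) f"
    using eventually_happens trivial_limit_at_right_real by blast
  then have "0 \<le> L" by (auto simp: lipschitz_on_def)
  moreover have "\<forall>\<^sub>F r in at_right 0. \<forall>x\<in>S. \<forall>y\<in>S. norm (x - a) \<le> r \<longrightarrow> norm (y - a) \<le> r \<longrightarrow>
    \<bar>f x - f y\<bar> \<le> L * norm (x - y)"
    using L by eventually_elim (auto simp: lipschitz_on_def dist_norm norm_minus_commute)
  ultimately show ?thesis using that by blast
qed

lemma lip_at_near:
  assumes "lip_at S a f" "a \<in> S" "0 < e"
  shows "\<forall>\<^sub>F r in at_right 0. \<forall>x\<in>S. norm (x - a) \<le> r \<longrightarrow> \<bar>f x - f a\<bar> < e"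
proof -
  obtain L where L: "0 \<le> L" "\<forall>\<^sub>F r in at_right 0. \<forall>x\<in>S. \<forall>y\<in>S. norm (x - a) \<le> r \<longrightarrow> norm (y - a) \<le> r \<longrightarrow>
    \<bar>f x - f y\<bar> \<le> L * norm (x - y)" using assms lip_atE by blast
  have "\<forall>\<^sub>F r in at_right 0. r < e / (L + 1)" "\<forall>\<^sub>F r in at_right (0::real). 0 < r"
    using eventually_at_right_real[of 0 "e / (L + 1)"] L(1) assms(3) eventually_at_right_less
    by (auto elim: eventually_mono)
  with L(2) show ?thesis
  proof eventually_elim
    case (elim r)
    show ?case
    proof (intro ballI impI)
      fix x assume x: "x \<in> S" "norm (x - a) \<le> r"
      then have "\<bar>f x - f a\<bar> \<le> L * norm (x - a)" using elim assms(2) by auto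
      also have "\<dots> \<le> L * r" using x L(1) by (intro mult_left_mono) auto
      also have "\<dots> < (L + 1) * r" using elim by simp
      also have "\<dots> < e" using elim L(1) by (simp add: field_simps)
      finally show "\<bar>f x - f a\<bar> < e" .
    qed
  qed
qed

lemma lip_at_const [intro, simp]: "lip_at S a (\<lambda>x. c)"
  by (rule lip_atI[of 1 _ _ _ 0]) auto

lemma lip_at_nth [intro, simp]: "lip_at S a (\<lambda>x::real^'n. x $ i)"
  by (rule lip_atI[of 1 _ _ _ 1]) (auto simp flip: vector_minus_component simp: component_le_norm_cart)

lemma lip_at_add [intro]:
  assumes "lip_at S a f" "lip_at S a g"
  shows "lip_at S a (\<lambda>x. f x + g x)"
proof -
  from assms obtain L L' where "\<forall>\<^sub>F r in at_right 0. L-lipschitz_on (S \<inter> cball a r) f"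
     "\<forall>\<^sub>F r in at_right 0. L'-lipschitz_on (S \<inter> cball a r) g" unfolding lip_at_def by blast
  then have "\<forall>\<^sub>F r in at_right 0. (L + L')-lipschitz_on (S \<inter> cball a r) (\<lambda>x. f x + g x)"
    by eventually_elim (rule lipschitz_on_add)
  then show ?thesis unfolding lip_at_def by blast
qed

lemma lip_at_mult [intro]:
  assumes "a \<in> S" "lip_at S a f" "lip_at S a g"
  shows "lip_at S a (\<lambda>x. f x * g x)"
proof -
  obtain L where L: "0 \<le> L" "\<forall>\<^sub>F r in at_right 0. \<forall>x\<in>S. \<forall>y\<in>S. norm (x - a) \<le> r \<longrightarrow> norm (y - a) \<le> r \<longrightarrow>
    \<bar>f x - f y\<bar> \<le> L * norm (x - y)" using assms lip_atE by blast
  obtain L' where L': "0 \<le> L'" "\<forall>\<^sub>F r in at_right 0. \<forall>x\<in>S. \<forall>y\<in>S. norm (x - a) \<le> r \<longrightarrow> norm (y - a) \<le> r \<longrightarrow>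
    \<bar>g x - g y\<bar> \<le> L' * norm (x - y)" using assms lip_atE by blast
  note nf = lip_at_near[OF assms(2,1) zero_less_one]
  note ng = lip_at_near[OF assms(3,1) zero_less_one]
  have "\<forall>\<^sub>F r in at_right (0::real). 0 < r" by (rule eventually_at_right_less)
  \<comment> \<open>The target does not mention the radius; placing it under the filter lets one
    radius that meets all four conditions be picked at the end.\<close>
  with L(2) L'(2) nf ng
  have "\<forall>\<^sub>F r in at_right (0::real). 0 < r \<and> lip_at S a (\<lambda>x. f x * g x)"
  proof eventually_elim
    case (elim r)
    show ?case
    proof (rule conjI[OF elim(5) lip_atI[OF elim(5)]])
      fix x y assume xy: "x \<in> S" "y \<in> S" "norm (x - a) \<le> r" "norm (y - a) \<le> r"
      have fx: "\<bar>f x\<bar> \<le> \<bar>f a\<bar> + 1" using elim(3) xy by force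
      have gy: "\<bar>g y\<bar> \<le> \<bar>g a\<bar> + 1" using elim(4) xy by force
      have "f x * g x - f y * g y = f x * (g x - g y) + (f x - f y) * g y" by (simp add: algebra_simps)
      then have "\<bar>f x * g x - f y * g y\<bar> \<le> \<bar>f x\<bar> * \<bar>g x - g y\<bar> + \<bar>f x - f y\<bar> * \<bar>g y\<bar>"
        by (metis abs_mult abs_triangle_ineq)
      also have "\<dots> \<le> (\<bar>f a\<bar> + 1) * (L' * norm (x - y)) + (L * norm (x - y)) * (\<bar>g a\<bar> + 1)"
        using elim xy L L' fx gy by (intro add_mono mult_mono) auto
      finally show "\<bar>f x * g x - f y * g y\<bar> \<le> ((\<bar>f a\<bar> + 1) * L' + L * (\<bar>g a\<bar> + 1)) * norm (x - y)"
        by (simp add: algebra_simps)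
    qed
  qed
  from eventually_happens[OF this] show ?thesis by (simp add: trivial_limit_at_right_real)
qed

lemma lip_at_inverse:
  assumes "a \<in> S" "lip_at S a g" "g a \<noteq> 0"
  shows "lip_at S a (\<lambda>x. inverse (g x))"
proof -
  obtain L where L: "0 \<le> L" "\<forall>\<^sub>F r in at_right 0. \<forall>x\<in>S. \<forall>y\<in>S. norm (x - a) \<le> r \<longrightarrow> norm (y - a) \<le> r \<longrightarrow>
    \<bar>g x - g y\<bar> \<le> L * norm (x - y)" using assms lip_atE by blast
  define m where "m = \<bar>g a\<bar> / 2"
  have m: "0 < m" using assms by (simp add: m_def)
  note ng = lip_at_near[OF assms(2,1) m]
  have "\<forall>\<^sub>F r in at_right (0::real). 0 < r" by (rule eventually_at_right_less)
  with L(2) ng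
  have "\<forall>\<^sub>F r in at_right (0::real). 0 < r \<and> lip_at S a (\<lambda>x. inverse (g x))"
  proof eventually_elim
    case (elim r)
    show ?case
    proof (rule conjI[OF elim(3) lip_atI[OF elim(3)]])
      fix x y assume xy: "x \<in> S" "y \<in> S" "norm (x - a) \<le> r" "norm (y - a) \<le> r"
      have gx: "m \<le> \<bar>g x\<bar>" using elim(2)[unfolded m_def, rule_format, OF xy(1,3)] unfolding m_def by linarith
      have gy: "m \<le> \<bar>g y\<bar>" using elim(2)[unfolded m_def, rule_format, OF xy(2,4)] unfolding m_def by linarith
      have "inverse (g x) - inverse (g y) = (g y - g x) / (g x * g y)"
        using gx gy m by (auto simp: field_simps)
      then have "\<bar>inverse (g x) - inverse (g y)\<bar> = \<bar>g x - g y\<bar> / (\<bar>g x\<bar> * \<bar>g y\<bar>)"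
        by (simp add: abs_mult abs_minus_commute)
      also have "\<dots> \<le> (L * norm (x - y)) / (m * m)"
        using elim xy L gx gy m by (intro frac_le mult_mono) auto
      finally show "\<bar>inverse (g x) - inverse (g y)\<bar> \<le> L / (m * m) * norm (x - y)" by simp
    qed
  qed
  from eventually_happens[OF this] show ?thesis by (simp add: trivial_limit_at_right_real)
qed

lemma lip_at_divide:
  assumes "a \<in> S" "lip_at S a f" "lip_at S a g" "g a \<noteq> 0"
  shows "lip_at S a (\<lambda>x. f x / g x)"
  unfolding divide_inverse using assms by (intro lip_at_mult lip_at_inverse)

lemma lip_at_diff [intro]:
  assumes "a \<in> S" "lip_at S a f" "lip_at S a g"
  shows "lip_at S a (\<lambda>x. f x - g x)"
  using lip_at_add[OF assms(2) lip_at_mult[OF assms(1) lip_at_const assms(3), of "-1"]] by simp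

lemma lip_at_sum [intro]:
  assumes "\<And>i. i \<in> I \<Longrightarrow> lip_at S a (f i)"
  shows "lip_at S a (\<lambda>x. \<Sum>i\<in>I. f i x)"
  using assms by (induction I rule: infinite_finite_induct) auto

lemma lip_at_prod [intro]:
  assumes "a \<in> S" "\<And>i. i \<in> I \<Longrightarrow> lip_at S a (f i)"
  shows "lip_at S a (\<lambda>x. \<Prod>i\<in>I. f i x)"
  using assms(2) by (induction I rule: infinite_finite_induct) (auto intro: assms(1))

lemma lip_at_det:
  fixes B :: "'a::real_normed_vector \<Rightarrow> real^'n^'n"
  assumes "a \<in> S" "\<And>i j. lip_at S a (\<lambda>x. B x $ i $ j)"
  shows "lip_at S a (\<lambda>x. det (B x))"
  unfolding det_def using assms by (intro lip_at_sum lip_at_mult lip_at_const lip_at_prod)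

text \<open>At 0 the one-sided difference quotient is \<open>x powr (\<alpha> - 1)\<close>, which
  tends to 0 because \<alpha> > 1. This makes \<open>pifun\<close> differentiable at points with
  zero coordinates.\<close>

lemma powr_has_derivative_nonneg:
  fixes a \<alpha> :: real
  assumes "0 \<le> a" "1 < \<alpha>"
  shows "((\<lambda>x. x powr \<alpha>) has_real_derivative \<alpha> * a powr (\<alpha> - 1)) (at a within {0..})"
proof (cases "a = 0")
  case False
  then show ?thesis using assms
    by (intro has_field_derivative_at_within[OF has_real_derivative_powr]) auto
next
  case True
  have "((\<lambda>x::real. x powr (\<alpha> - 1)) \<longlongrightarrow> 0) (at_right 0)"
  proof -
    have "((\<lambda>x::real. x powr (\<alpha> - 1)) \<longlongrightarrow> 0 powr (\<alpha> - 1)) (at_right 0)"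
      using assms(2) by (intro tendsto_powr' tendsto_ident_at tendsto_const disjI2 conjI
          eventually_mono[OF eventually_at_right_less]) auto
    then show ?thesis by simp
  qed
  then have "((\<lambda>y. (y powr \<alpha> - 0 powr \<alpha>) / (y - 0)) \<longlongrightarrow> 0) (at_right 0)"
    by (rule Lim_transform_eventually) (auto simp: eventually_at_right_field powr_diff intro!: exI[of _ 1])
  moreover have "(at 0 within {0..}) = at_right (0::real)"
  proof -
    have "{0..} - {0} = ({0<..} - {0} :: real set)" by auto
    then show ?thesis unfolding at_within_def by simp
  qed
  ultimately show ?thesis using assms True by (simp add: has_field_derivative_iff)
qed

lemma powr_lipschitz:
  fixes x y \<alpha> c :: real
  assumes "0 \<le> x" "x \<le> c" "0 \<le> y" "y \<le> c" "1 < \<alpha>"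
  shows "\<bar>x powr \<alpha> - y powr \<alpha>\<bar> \<le> \<alpha> * c powr (\<alpha> - 1) * \<bar>x - y\<bar>"
proof -
  have "norm (x powr \<alpha> - y powr \<alpha>) \<le> (\<alpha> * c powr (\<alpha> - 1)) * norm (x - y)"
  proof (rule field_differentiable_bound[of "{0..c}" "\<lambda>x. x powr \<alpha>" "\<lambda>a. \<alpha> * a powr (\<alpha> - 1)"])
    fix z assume "z \<in> {0..c}"
    then show "((\<lambda>x. x powr \<alpha>) has_field_derivative \<alpha> * z powr (\<alpha> - 1)) (at z within {0..c})"
      using assms by (intro has_field_derivative_subset[OF powr_has_derivative_nonneg]) auto
    show "norm (\<alpha> * z powr (\<alpha> - 1)) \<le> \<alpha> * c powr (\<alpha> - 1)"
      using \<open>z \<in> {0..c}\<close> assms by (auto simp: abs_mult intro!: powr_mono2)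
  qed (use assms in auto)
  then show ?thesis by simp
qed

abbreviation orthant :: "(real^'n) set" where
  "orthant \<equiv> {x. \<forall>i. 0 \<le> x$i}"

lemma lip_at_powr_nth:
  fixes a :: "real^'n"
  assumes "a \<in> orthant" "1 < \<alpha>"
  shows "lip_at orthant a (\<lambda>x. x$i powr \<alpha>)"
proof (rule lip_atI[of 1])
  fix x y :: "real^'n" assume xy: "x \<in> orthant" "y \<in> orthant" "norm (x - a) \<le> 1" "norm (y - a) \<le> 1"
  have b: "z $ i \<le> norm a + 1" if "norm (z - a) \<le> 1" for z
  proof -
    have "z $ i \<le> norm z" using component_le_norm_cart[of z i] by simp
    also have "\<dots> \<le> norm a + norm (z - a)" using norm_triangle_sub by blast
    finally show ?thesis using that by simp
  qed
  have "\<bar>x$i powr \<alpha> - y$i powr \<alpha>\<bar> \<le> \<alpha> * (norm a + 1) powr (\<alpha> - 1) * \<bar>x$i - y$i\<bar>"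
    using xy b assms(2) by (intro powr_lipschitz) auto
  also have "\<dots> \<le> \<alpha> * (norm a + 1) powr (\<alpha> - 1) * norm (x - y)"
    using assms(2) component_le_norm_cart[of "x - y" i] by (intro mult_left_mono) auto
  finally show "\<bar>x$i powr \<alpha> - y$i powr \<alpha>\<bar> \<le> \<alpha> * (norm a + 1) powr (\<alpha> - 1) * norm (x - y)" .
qed simp

subsection \<open>Transition kernel and Poisson equation\<close>

locale reinforcement =
  fixes A :: "real^'n^'n" and \<alpha> :: real
  assumes card2: "2 \<le> CARD('n)" and alpha: "1 < \<alpha>" and adm: "admissible_matrix A"
begin

lemma A_sym: "A$i$j = A$j$i"
  using adm unfolding admissible_matrix_def transpose_def by (metis vec_lambda_beta)

lemma A_nonneg [simp]: "0 \<le> A$i$j"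
  using adm unfolding admissible_matrix_def by blast

lemma A_pos: "i \<noteq> j \<Longrightarrow> 0 < A$i$j"
  using adm unfolding admissible_matrix_def by blast

definition den :: "real^'n \<Rightarrow> 'n \<Rightarrow> real" where
  "den w i = (\<Sum>k\<in>UNIV. A$i$k * w$k powr \<alpha>)"

definition kern :: "real^'n \<Rightarrow> 'n \<Rightarrow> 'n \<Rightarrow> real" where
  "kern w i j = A$i$j * w$j powr \<alpha> / den w i"

text \<open>The points at which every row of \<open>kern\<close> is a probability vector, including
  the rows of states of zero weight. Smoothed frequencies qualify since their coordinates are
  positive; the equilibrium may have zero coordinates and needs its own argument.\<close>

definition regular :: "real^'n \<Rightarrow> bool" where
  "regular w \<longleftrightarrow> w \<in> orthant \<and> (\<forall>i. 0 < den w i)"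

text \<open>The fundamental matrix I - K + 1 pi^T of Markov chain theory: I - K annihilates
  constants, and the rank-one term restores invertibility without changing the action on vectors of
  mean zero under \<open>pifun\<close>.\<close>

definition fundamental :: "real^'n \<Rightarrow> real^'n^'n" where
  "fundamental w = (\<chi> i j. (if i = j then 1 else 0) - kern w i j + pifun A \<alpha> w $ j)"

text \<open>By Cramer's rule these are the entries of the inverse of \<open>fundamental w\<close>; written this way
  they are visibly locally Lipschitz in \<open>w\<close>.\<close>
definition green :: "real^'n \<Rightarrow> 'n \<Rightarrow> 'n \<Rightarrow> real" where
  "green w x i = det (\<chi> r s. if s = x then (if r = i then 1 else 0) else fundamental w $ r $ s) /
     det (fundamental w)"

text \<open>The mean of \<open>green\<close> at the next state, seen from the current one. The
  difference of the two is the centred indicator of a state, by \<open>poisson\<close>.\<close>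

definition corrector :: "real^'n \<Rightarrow> 'n \<Rightarrow> 'n \<Rightarrow> real" where
  "corrector w x i = (\<Sum>y\<in>UNIV. kern w x y * green w y i)"

lemma Hfun_den: "Hfun A \<alpha> w = (\<Sum>i\<in>UNIV. w$i powr \<alpha> * den w i)"
  unfolding Hfun_def den_def by (simp add: sum_distrib_left mult_ac)

lemma pifun_den: "pifun A \<alpha> w $ i = w$i powr \<alpha> * den w i / Hfun A \<alpha> w"
  unfolding pifun_def den_def by simp

lemma regular_pos:
  assumes "\<And>i. 0 < w$i"
  shows "regular w"
  unfolding regular_def
proof (intro conjI allI)
  show "w \<in> orthant" using assms by (auto simp: less_imp_le)
  fix i :: 'n
  have "UNIV \<noteq> {i}" using card2 by (auto dest: arg_cong[where f = card])
  then obtain k where "k \<noteq> i" by blast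
  then have "0 < A$i$k * w$k powr \<alpha>" using A_pos[of i k] assms[of k] by simp
  moreover have "A$i$k * w$k powr \<alpha> \<le> den w i" unfolding den_def
    by (rule member_le_sum) auto
  ultimately show "0 < den w i" by linarith
qed

text \<open>\<open>den v i\<close> could vanish only if all the mass of \<open>v\<close> sat at
  \<open>i\<close> and \<open>A $ i $ i = 0\<close>; the bound 3/4 in \<open>Delta\<close> excludes
  this.\<close>

lemma regular_Delta:
  assumes "v \<in> Delta A"
  shows "regular v"
  unfolding regular_def
proof (intro conjI allI)
  show orth: "v \<in> orthant" using assms by (auto simp: Delta_def)
  have sum1: "(\<Sum>i\<in>UNIV. v$i) = 1" using assms by (auto simp: Delta_def)
  fix i :: 'n
  have "\<exists>k. 0 < A$i$k * v$k powr \<alpha>"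
  proof (cases "\<exists>k. k \<noteq> i \<and> v$k \<noteq> 0")
    case True
    then obtain k where "k \<noteq> i" "v$k \<noteq> 0" by blast
    then show ?thesis using A_pos[of i k] orth by (intro exI[of _ k]) (simp add: order_less_le)
  next
    case False
    then have "(\<Sum>k\<in>UNIV. v$k) = (\<Sum>k\<in>{i}. v$k)" by (intro sum.mono_neutral_right) auto
    then have vi: "v$i = 1" using sum1 by simp
    then have "A$i$i \<noteq> 0" using assms by (auto simp: Delta_def)
    then have "0 < A$i$i" using A_nonneg[of i i] by linarith
    then show ?thesis using vi by (intro exI[of _ i]) simp
  qed
  then obtain k where k: "0 < A$i$k * v$k powr \<alpha>" by blast
  also have "A$i$k * v$k powr \<alpha> \<le> den v i" unfolding den_def
    by (rule member_le_sum) auto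
  finally show "0 < den v i" .
qed

context
  fixes w :: "real^'n"
  assumes reg: "regular w"
begin

lemma w_nonneg: "0 \<le> w$i"
  using reg by (simp add: regular_def)

lemma den_pos: "0 < den w i"
  using reg by (simp add: regular_def)

lemma Hfun_pos: "0 < Hfun A \<alpha> w"
proof -
  have "\<exists>k. w$k \<noteq> 0"
  proof (rule ccontr)
    assume "\<not> (\<exists>k. w$k \<noteq> 0)"
    then have "den w undefined = 0" unfolding den_def by simp
    then show False using den_pos[of undefined] by simp
  qed
  then obtain k where "w$k \<noteq> 0" by blast
  then have "0 < w$k powr \<alpha> * den w k" using w_nonneg[of k] den_pos[of k] by simp
  also have "\<dots> \<le> Hfun A \<alpha> w" unfolding Hfun_den
    by (rule member_le_sum) (auto intro!: mult_nonneg_nonneg less_imp_le[OF den_pos])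
  finally show ?thesis .
qed

lemma pifun_nonneg: "0 \<le> pifun A \<alpha> w $ i"
  unfolding pifun_den using den_pos[of i] Hfun_pos by simp

lemma sum_pifun: "(\<Sum>i\<in>UNIV. pifun A \<alpha> w $ i) = 1"
  unfolding pifun_den using Hfun_pos by (simp flip: sum_divide_distrib Hfun_den)

lemma kern_nonneg: "0 \<le> kern w i j"
  unfolding kern_def using den_pos[of i] by simp

lemma sum_kern: "(\<Sum>j\<in>UNIV. kern w i j) = 1"
  unfolding kern_def using den_pos[of i] by (simp flip: sum_divide_distrib den_def)

text \<open>The factor \<open>den w i\<close> cancels, leaving
  \<open>w $ i powr \<alpha> * A $ i $ j * w $ j powr \<alpha>\<close> over \<open>Hfun\<close>,
  which is symmetric as \<open>A\<close> is.\<close>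

lemma pifun_reversible: "pifun A \<alpha> w $ i * kern w i j = pifun A \<alpha> w $ j * kern w j i"
  unfolding pifun_den kern_def using den_pos[of i] den_pos[of j] A_sym[of i j] by simp

lemma pifun_stationary: "(\<Sum>i\<in>UNIV. pifun A \<alpha> w $ i * kern w i j) = pifun A \<alpha> w $ j"
  by (simp add: pifun_reversible[of _ j] sum_kern flip: sum_distrib_left)

lemma kern_zero_iff: "kern w i j = 0 \<longleftrightarrow> A$i$j = 0 \<or> w$j = 0"
  unfolding kern_def using den_pos[of i] by simp

lemma pifun_zero_iff: "pifun A \<alpha> w $ i = 0 \<longleftrightarrow> w$i = 0"
  unfolding pifun_den using den_pos[of i] Hfun_pos by simp

text \<open>The Dirichlet form of \<open>z\<close> vanishes, so \<open>z\<close> is constant on the support of \<open>w\<close>.\<close>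
lemma harmonic_const:
  assumes harm: "\<And>x. (\<Sum>y\<in>UNIV. kern w x y * z y) = z x"
  obtains c where "\<And>x. z x = c"
proof -
  let ?p = "\<lambda>x. pifun A \<alpha> w $ x"
  have a: "(\<Sum>x\<in>UNIV. \<Sum>y\<in>UNIV. ?p x * kern w x y * (z x)\<^sup>2) = (\<Sum>x\<in>UNIV. ?p x * (z x)\<^sup>2)"
    by (simp add: sum_kern flip: sum_distrib_left sum_distrib_right)
  have b: "(\<Sum>x\<in>UNIV. \<Sum>y\<in>UNIV. ?p x * kern w x y * (z y)\<^sup>2) = (\<Sum>x\<in>UNIV. ?p x * (z x)\<^sup>2)"
    by (subst sum.swap) (simp add: pifun_stationary flip: sum_distrib_right)
  have "(\<Sum>x\<in>UNIV. \<Sum>y\<in>UNIV. ?p x * kern w x y * (z x * z y)) =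
    (\<Sum>x\<in>UNIV. ?p x * z x * (\<Sum>y\<in>UNIV. kern w x y * z y))"
    by (simp add: sum_distrib_left mult_ac)
  then have c: "(\<Sum>x\<in>UNIV. \<Sum>y\<in>UNIV. ?p x * kern w x y * (z x * z y)) = (\<Sum>x\<in>UNIV. ?p x * (z x)\<^sup>2)"
    by (simp only: harm) (simp add: power2_eq_square mult_ac)
  have "(\<Sum>x\<in>UNIV. \<Sum>y\<in>UNIV. ?p x * kern w x y * (z x - z y)\<^sup>2) =
     (\<Sum>x\<in>UNIV. \<Sum>y\<in>UNIV. ?p x * kern w x y * (z x)\<^sup>2 + ?p x * kern w x y * (z y)\<^sup>2
        - 2 * (?p x * kern w x y * (z x * z y)))"
    by (intro sum.cong refl) (simp add: power2_eq_square algebra_simps)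
  also have "\<dots> = 0"
    by (simp add: sum.distrib sum_subtractf a b c flip: sum_distrib_left)
  finally have "(\<Sum>x\<in>UNIV. \<Sum>y\<in>UNIV. ?p x * kern w x y * (z x - z y)\<^sup>2) = 0" .
  then have "\<forall>x y. ?p x * kern w x y * (z x - z y)\<^sup>2 = 0"
    by (simp add: sum_nonneg_eq_0_iff sum_nonneg pifun_nonneg kern_nonneg)
  then have zero: "?p x * kern w x y * (z x - z y)\<^sup>2 = 0" for x y by blast
  have const: "z x = z y" if "w$x \<noteq> 0" "w$y \<noteq> 0" for x y
  proof (cases "x = y")
    case False
    then show ?thesis using zero[of x y] that A_pos[OF False] by (simp add: pifun_zero_iff kern_zero_iff)
  qed simp
  obtain s where s: "w$s \<noteq> 0"
    using sum_pifun pifun_zero_iff by (metis sum.neutral zero_neq_one)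
  \<comment> \<open>From any state, on the support or not, the chain jumps into the support, where
    \<open>z\<close> is constant; harmonicity transports that value to \<open>x\<close>.\<close>
  have "z x = z s" for x
  proof -
    have "z x = (\<Sum>y\<in>UNIV. kern w x y * z s)"
      unfolding harm[of x, symmetric]
    proof (intro sum.cong refl)
      fix y show "kern w x y * z y = kern w x y * z s"
        using const[of y s] s kern_zero_iff[of x y] by (cases "w$y = 0") auto
    qed
    then show ?thesis by (simp add: sum_kern flip: sum_distrib_right)
  qed
  then show ?thesis using that by blast
qed

lemma fundamental_mult:
  "(fundamental w *v z) $ x = z$x - (\<Sum>y\<in>UNIV. kern w x y * z$y) + (\<Sum>y\<in>UNIV. pifun A \<alpha> w $ y * z$y)"
proof -
  have "(fundamental w *v z) $ x =
    (\<Sum>y\<in>UNIV. (if x = y then z$y else 0) - kern w x y * z$y + pifun A \<alpha> w $ y * z$y)"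
    unfolding fundamental_def matrix_vector_mult_def by (auto intro!: sum.cong simp: algebra_simps)
  then show ?thesis by (simp add: sum.distrib sum_subtractf)
qed

text \<open>The stationary law is fixed from the left by \<open>kern w\<close> and by the rank-one
  term, hence by their combination with the identity.\<close>

lemma pifun_fundamental:
  "(\<Sum>x\<in>UNIV. pifun A \<alpha> w $ x * (fundamental w *v z) $ x) = (\<Sum>y\<in>UNIV. pifun A \<alpha> w $ y * z$y)"
proof -
  let ?p = "\<lambda>x. pifun A \<alpha> w $ x"
  have "(\<Sum>x\<in>UNIV. ?p x * (\<Sum>y\<in>UNIV. kern w x y * z$y)) = (\<Sum>y\<in>UNIV. \<Sum>x\<in>UNIV. ?p x * kern w x y * z$y)"
    by (subst sum.swap) (simp add: sum_distrib_left mult_ac)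
  then have "(\<Sum>x\<in>UNIV. ?p x * (\<Sum>y\<in>UNIV. kern w x y * z$y)) = (\<Sum>y\<in>UNIV. ?p y * z$y)"
    by (simp add: pifun_stationary flip: sum_distrib_right)
  moreover have "(\<Sum>x\<in>UNIV. ?p x * (\<Sum>y\<in>UNIV. ?p y * z$y)) = (\<Sum>y\<in>UNIV. ?p y * z$y)"
    by (simp add: sum_pifun flip: sum_distrib_right)
  ultimately show ?thesis
    by (simp add: fundamental_mult distrib_left right_diff_distrib sum.distrib sum_subtractf)
qed

text \<open>A kernel vector has mean zero under \<open>pifun\<close>, so the rank-one term drops out
  and it is harmonic, hence constant, hence zero.\<close>

lemma det_fundamental: "det (fundamental w) \<noteq> 0"
proof -
  have "z = 0" if z: "fundamental w *v z = 0" for z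
  proof -
    have p0: "(\<Sum>y\<in>UNIV. pifun A \<alpha> w $ y * z$y) = 0"
      using pifun_fundamental[of z] z by simp
    have "(\<Sum>y\<in>UNIV. kern w x y * z$y) = z$x" for x
      using fundamental_mult[of z x] z p0 by simp
    then obtain c where c: "\<And>x. z$x = c" using harmonic_const by blast
    with p0 have "c = 0" by (simp add: sum_pifun flip: sum_distrib_right)
    with c show "z = 0" by (simp add: vec_eq_iff)
  qed
  then show ?thesis
    by (metis invertible_det_nz invertible_left_inverse matrix_left_invertible_ker)
qed

text \<open>By Cramer's rule column \<open>i\<close> of \<open>green\<close> is mapped by
  \<open>fundamental w\<close> to the unit vector. Pairing with the stationary law shows that its
  mean is \<open>pifun A \<alpha> w $ i\<close>, and row \<open>x\<close> of the linear system is
  then the claim.\<close>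

lemma poisson: "green w x i - corrector w x i = (if x = i then 1 else 0) - pifun A \<alpha> w $ i"
proof -
  let ?z = "\<chi> k. det (\<chi> r s. if s = k then axis i 1 $ r else fundamental w $ r $ s) / det (fundamental w)"
  have z: "fundamental w *v ?z = axis i 1"
    using cramer[OF det_fundamental] by blast
  have g: "?z $ y = green w y i" for y
    unfolding green_def axis_def vec_lambda_beta by (simp add: eq_commute)
  show ?thesis
    using fundamental_mult[of ?z x] pifun_fundamental[of ?z]
    unfolding z g corrector_def by (cases "x = i") (simp_all add: axis_def if_distrib cong: if_cong)
qed

text \<open>The form needed for the drift: averaged over one step, the noise is the corrector now
  minus the expected corrector after the step, with \<open>w\<close> frozen.\<close>

lemma kern_corrector:
  "(\<Sum>y\<in>UNIV. kern w x y * ((if y = i then 1 else 0) - pifun A \<alpha> w $ i)) =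
    corrector w x i - (\<Sum>y\<in>UNIV. kern w x y * corrector w y i)"
  unfolding corrector_def[of w x] by (simp add: right_diff_distrib sum_subtractf flip: poisson)

section \<open>Lipschitz dependence of kernel, stationary law and corrector on the
  frequencies\<close>

lemma lip_at_powr: "lip_at orthant w (\<lambda>v. v$i powr \<alpha>)"
  using reg alpha by (intro lip_at_powr_nth) (auto simp: regular_def)

lemma reg_orthant: "w \<in> orthant"
  using reg by (simp add: regular_def)

lemma lip_at_den: "lip_at orthant w (\<lambda>v. den v i)"
  unfolding den_def by (intro lip_at_sum lip_at_mult lip_at_const lip_at_powr reg_orthant)

lemma lip_at_kern: "lip_at orthant w (\<lambda>v. kern v i j)"
  unfolding kern_def using den_pos[of i]
  by (intro lip_at_divide lip_at_mult lip_at_const lip_at_powr lip_at_den reg_orthant) simp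

lemma lip_at_pifun: "lip_at orthant w (\<lambda>v. pifun A \<alpha> v $ i)"
  unfolding pifun_den Hfun_den using Hfun_pos[unfolded Hfun_den]
  by (intro lip_at_divide lip_at_mult lip_at_sum lip_at_const lip_at_powr lip_at_den reg_orthant) simp

lemma lip_at_fundamental: "lip_at orthant w (\<lambda>v. fundamental v $ i $ j)"
  unfolding fundamental_def vec_lambda_beta
  by (intro lip_at_add lip_at_diff lip_at_const lip_at_kern lip_at_pifun reg_orthant)

lemma lip_at_green: "lip_at orthant w (\<lambda>v. green v x i)"
  unfolding green_def
proof (intro lip_at_divide lip_at_det lip_at_fundamental reg_orthant det_fundamental)
  fix r s :: 'n
  show "lip_at orthant w (\<lambda>v. (\<chi> r s. if s = x then (if r = i then 1 else 0) else fundamental v $ r $ s) $ r $ s)"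
    using lip_at_fundamental by (cases "s = x") auto
qed

lemma lip_at_corrector: "lip_at orthant w (\<lambda>v. corrector v x i)"
  unfolding corrector_def by (intro lip_at_sum lip_at_mult lip_at_kern lip_at_green reg_orthant)

end

end

subsection \<open>Self-adjointness of the differential at an equilibrium\<close>

lemma zero_of_quadratic_nonneg:
  fixes b q :: real
  assumes "\<And>t. 0 \<le> 2 * t * b + t\<^sup>2 * q"
  shows "b = 0"
proof (rule ccontr)
  assume "b \<noteq> 0"
  have q: "0 \<le> q" using assms[of 1] assms[of "-1"] by simp
  \<comment> \<open>The minimiser would be \<open>- b / q\<close>; using \<open>q + 1\<close>
    instead covers \<open>q = 0\<close> and still gives a negative value.\<close>
  define r where "r = q + 1"
  have r: "0 < r" "q = r - 1" using q by (auto simp: r_def)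
  have "2 * (- b / r) * b + (- b / r)\<^sup>2 * q = - b\<^sup>2 * (q + 2) / r\<^sup>2"
    unfolding r(2) using r(1) by (simp add: field_simps power2_eq_square)
  also have "\<dots> < 0" using q r \<open>b \<noteq> 0\<close> by (intro divide_neg_pos mult_neg_pos) auto
  finally show False using assms[of "- b / r"] by linarith
qed

definition wdot :: "('n \<Rightarrow> real) \<Rightarrow> real^'n \<Rightarrow> real^'n \<Rightarrow> real" where
  "wdot om x y = (\<Sum>i\<in>UNIV. om i * x$i * y$i)"

lemma wdot_commute: "wdot om x y = wdot om y x"
  unfolding wdot_def by (simp add: mult_ac)

lemma wdot_add_left: "wdot om (x + y) z = wdot om x z + wdot om y z"
  and wdot_scale_left: "wdot om (c *\<^sub>R x) z = c * wdot om x z"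
  and wdot_diff_left: "wdot om (x - y) z = wdot om x z - wdot om y z"
  unfolding wdot_def by (simp_all add: algebra_simps sum.distrib sum_subtractf sum_distrib_left)

lemma wdot_add_right: "wdot om z (x + y) = wdot om z x + wdot om z y"
  and wdot_scale_right: "wdot om z (c *\<^sub>R x) = c * wdot om z x"
  and wdot_diff_right: "wdot om z (x - y) = wdot om z x - wdot om z y"
  by (simp_all add: wdot_commute[of om z] wdot_add_left wdot_scale_left wdot_diff_left)

lemmas wdot_simps = wdot_add_left wdot_scale_left wdot_diff_left
  wdot_add_right wdot_scale_right wdot_diff_right

lemma wdot_eq_0_iff:
  assumes "\<And>i. 0 < om i"
  shows "wdot om x x = 0 \<longleftrightarrow> x = 0"
proof
  assume "wdot om x x = 0"
  then have "om i * x$i * x$i = 0" for i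
    unfolding wdot_def using assms
    by (subst (asm) sum_nonneg_eq_0_iff) (auto simp: mult.assoc less_imp_le)
  then show "x = 0" using assms by (simp add: vec_eq_iff) (metis less_irrefl)
qed (simp add: wdot_def)

lemma wdot_nonneg:
  assumes "\<And>i. 0 < om i"
  shows "0 \<le> wdot om x x"
  unfolding wdot_def using assms by (intro sum_nonneg) (auto simp: mult.assoc less_imp_le)

lemma norm_le_wdot:
  assumes "\<And>i. 1 \<le> om i"
  shows "(norm x)\<^sup>2 \<le> wdot om x x"
proof -
  have "(norm x)\<^sup>2 = (\<Sum>i\<in>UNIV. (x$i)\<^sup>2)"
    by (simp add: norm_vec_def L2_set_def sum_nonneg)
  also have "\<dots> \<le> wdot om x x"
    unfolding wdot_def
  proof (rule sum_mono)
    fix i show "(x$i)\<^sup>2 \<le> om i * x$i * x$i"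
      using mult_right_mono[OF assms[of i], of "(x$i)\<^sup>2"] by (simp add: power2_eq_square mult.assoc)
  qed
  finally show ?thesis .
qed

text \<open>The Rayleigh quotient attains its maximum on the compact Euclidean sphere; being
  homogeneous of degree 0 it is then maximal everywhere, and the first variation at the maximiser
  vanishes.\<close>

lemma selfadjoint_max_eigenvector:
  fixes D :: "real^'n \<Rightarrow> real^'n"
  assumes lin: "linear D" and om: "\<And>i. 0 < om i"
    and sym: "\<And>x y. wdot om x (D y) = wdot om y (D x)"
  obtains l x where "x \<noteq> 0" "D x = l *\<^sub>R x" "\<And>y. wdot om y (D y) \<le> l * wdot om y y"
proof -
  interpret D: linear D by (rule lin)
  have cD: "continuous_on UNIV D" using lin linear_continuous_on linear_linear by blast
  let ?f = "\<lambda>y. wdot om y (D y) / wdot om y y"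
  have pos: "0 < wdot om y y" if "y \<noteq> 0" for y
    using wdot_nonneg[of om y, OF om] wdot_eq_0_iff[of om y, OF om] that by linarith
  have "continuous_on (sphere 0 1) ?f"
  proof (rule continuous_on_divide)
    show "\<forall>y\<in>sphere 0 1. wdot om y y \<noteq> 0" using pos by (metis mem_sphere_0 less_irrefl norm_zero zero_neq_one)
  qed (unfold wdot_def, (intro continuous_intros continuous_on_subset[OF cD] subset_UNIV)+)
  moreover have "sphere (0::real^'n) 1 \<noteq> {}" by simp
  ultimately have "\<exists>x\<in>sphere 0 1. \<forall>y\<in>sphere 0 1. ?f y \<le> ?f x"
    by (intro continuous_attains_sup compact_sphere)
  then obtain x where x: "norm x = 1" and max: "\<And>y. norm y = 1 \<Longrightarrow> ?f y \<le> ?f x"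
    unfolding Ball_def Bex_def mem_sphere_0 by blast
  have x0: "x \<noteq> 0" using x by auto
  define l where "l = ?f x"
  have le: "wdot om y (D y) \<le> l * wdot om y y" for y
  proof (cases "y = 0")
    case False
    let ?c = "1 / norm y"
    have "?f (?c *\<^sub>R y) \<le> l" unfolding l_def using False by (intro max) simp
    moreover have "?f (?c *\<^sub>R y) = ?f y"
      using False by (simp add: wdot_simps D.scale)
    ultimately show ?thesis using pos[OF False] by (simp add: field_simps)
  qed (simp add: wdot_def D.zero)
  have eq: "wdot om x (D x) = l * wdot om x x" unfolding l_def using pos[OF x0] by simp
  \<comment> \<open>Perturbing the maximiser along its own eigenvector defect makes the linear
    coefficient in \<open>t\<close> equal to \<open>2 * wdot om z z\<close>, which must therefore
    vanish.\<close>
  define z where "z = l *\<^sub>R x - D x"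
  have "0 \<le> 2 * t * wdot om z z + t\<^sup>2 * (l * wdot om z z - wdot om z (D z))" for t
  proof -
    have "0 \<le> l * wdot om (x + t *\<^sub>R z) (x + t *\<^sub>R z) - wdot om (x + t *\<^sub>R z) (D (x + t *\<^sub>R z))"
      using le[of "x + t *\<^sub>R z"] by simp
    also have "D (x + t *\<^sub>R z) = D x + t *\<^sub>R D z" by (simp add: D.add D.scale)
    also have "l * wdot om (x + t *\<^sub>R z) (x + t *\<^sub>R z) - wdot om (x + t *\<^sub>R z) (D x + t *\<^sub>R D z)
      = 2 * t * (l * wdot om x z - wdot om z (D x)) + t\<^sup>2 * (l * wdot om z z - wdot om z (D z))"
      unfolding wdot_add_left wdot_add_right wdot_scale_left wdot_scale_right
      using eq sym[of x z] wdot_commute[of om x z]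
      by (simp only: power2_eq_square) (simp only: algebra_simps)
    also have "l * wdot om x z - wdot om z (D x) = wdot om z z"
      unfolding z_def by (simp add: wdot_simps wdot_commute[of om "D x" x] algebra_simps)
    finally show ?thesis .
  qed
  then have "wdot om z z = 0" by (rule zero_of_quadratic_nonneg)
  then have "z = 0" using wdot_eq_0_iff[of om, OF om] by blast
  then have "D x = l *\<^sub>R x" by (simp add: z_def)
  with x0 le show ?thesis using that by blast
qed

context reinforcement
begin

text \<open>The inner product with these weights makes the differential of \<open>pifun\<close> at an equilibrium
  self-adjoint, \<open>pifun\<close> being a gradient of \<open>ln H / (2 \<alpha>)\<close> up to the factors \<open>v $ i\<close>.\<close>
definition eq_weight :: "real^'n \<Rightarrow> 'n \<Rightarrow> real" where
  "eq_weight v i = (if v$i = 0 then 1 else 1 / v$i)"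

lemma powr_nth_has_derivative:
  assumes "v \<in> orthant"
  shows "((\<lambda>w::real^'n. w$i powr \<alpha>) has_derivative (\<lambda>x. \<alpha> * v$i powr (\<alpha> - 1) * x$i)) (at v within orthant)"
proof -
  have lin: "((\<lambda>w::real^'n. w$i) has_derivative (\<lambda>x. x$i)) (at v within orthant)"
    by (rule bounded_linear_imp_has_derivative) (rule bounded_linear_vec_nth)
  have "((\<lambda>x. x powr \<alpha>) has_derivative (*) (\<alpha> * v$i powr (\<alpha> - 1))) (at (v$i) within {0..})"
    using powr_has_derivative_nonneg[of "v$i" \<alpha>] assms alpha by (simp add: has_field_derivative_def)
  then have "((\<lambda>x. x powr \<alpha>) has_derivative (*) (\<alpha> * v$i powr (\<alpha> - 1))) (at (v$i) within (\<lambda>w. w$i) ` orthant)"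
    by (rule has_derivative_subset) auto
  from has_derivative_in_compose[OF lin this] show ?thesis by simp
qed

text \<open>Linear stability supplies an abstract derivative within the orthant; the quotient rule
  gives a concrete one, and uniqueness identifies them.\<close>

lemma pifun_derivative_explicit:
  assumes reg: "regular v" and D: "(pifun A \<alpha> has_derivative D) (at v within orthant)"
  defines "d \<equiv> \<lambda>i. \<alpha> * v$i powr (\<alpha> - 1)"
  shows "D x $ i = ((d i * x$i * den v i + v$i powr \<alpha> * (\<Sum>j\<in>UNIV. A$i$j * (d j * x$j))) * Hfun A \<alpha> v
     - v$i powr \<alpha> * den v i * (2 * (\<Sum>j\<in>UNIV. d j * x$j * den v j))) / (Hfun A \<alpha> v * Hfun A \<alpha> v)"
proof -
  have orth: "v \<in> orthant" using reg by (simp add: regular_def)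
  have P: "((\<lambda>w. w$i powr \<alpha>) has_derivative (\<lambda>x. d i * x$i)) (at v within orthant)" for i
    unfolding d_def by (rule powr_nth_has_derivative[OF orth])
  have Q: "((\<lambda>w. den w i) has_derivative (\<lambda>x. \<Sum>j\<in>UNIV. A$i$j * (d j * x$j))) (at v within orthant)" for i
    unfolding den_def by (intro has_derivative_sum has_derivative_mult_right P)
  have PQ: "((\<lambda>w. w$i powr \<alpha> * den w i) has_derivative
     (\<lambda>x. v$i powr \<alpha> * (\<Sum>j\<in>UNIV. A$i$j * (d j * x$j)) + d i * x$i * den v i)) (at v within orthant)" for i
    by (rule has_derivative_mult[OF P Q])
  have "(\<Sum>i\<in>UNIV. v$i powr \<alpha> * (\<Sum>j\<in>UNIV. A$i$j * (d j * x$j)) + d i * x$i * den v i)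
    = 2 * (\<Sum>j\<in>UNIV. d j * x$j * den v j)" for x
  proof -
    have "(\<Sum>i\<in>UNIV. v$i powr \<alpha> * (\<Sum>j\<in>UNIV. A$i$j * (d j * x$j))) =
      (\<Sum>j\<in>UNIV. \<Sum>i\<in>UNIV. v$i powr \<alpha> * (A$i$j * (d j * x$j)))"
      unfolding sum_distrib_left by (rule sum.swap)
    also have "\<dots> = (\<Sum>j\<in>UNIV. d j * x$j * den v j)"
      unfolding den_def sum_distrib_left by (intro sum.cong refl) (simp add: A_sym mult_ac)
    finally show ?thesis by (simp add: sum.distrib)
  qed
  moreover have "((\<lambda>w. Hfun A \<alpha> w) has_derivative
     (\<lambda>x. \<Sum>i\<in>UNIV. v$i powr \<alpha> * (\<Sum>j\<in>UNIV. A$i$j * (d j * x$j)) + d i * x$i * den v i)) (at v within orthant)"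
    unfolding Hfun_den by (intro has_derivative_sum PQ)
  ultimately have H: "((\<lambda>w. Hfun A \<alpha> w) has_derivative (\<lambda>x. 2 * (\<Sum>j\<in>UNIV. d j * x$j * den v j)))
     (at v within orthant)" by simp
  have E: "((\<lambda>w. pifun A \<alpha> w $ i) has_derivative (\<lambda>x.
     ((v$i powr \<alpha> * (\<Sum>j\<in>UNIV. A$i$j * (d j * x$j)) + d i * x$i * den v i) * Hfun A \<alpha> v
     - v$i powr \<alpha> * den v i * (2 * (\<Sum>j\<in>UNIV. d j * x$j * den v j))) / (Hfun A \<alpha> v * Hfun A \<alpha> v)))
     (at v within orthant)"
    unfolding pifun_den using Hfun_pos[OF reg] by (intro has_derivative_divide' PQ H) simp
  have F: "((\<lambda>w. pifun A \<alpha> w $ i) has_derivative (\<lambda>x. D x $ i)) (at v within orthant)"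
    by (rule bounded_linear.has_derivative[OF bounded_linear_vec_nth D])
  have "(\<lambda>x. D x $ i) = (\<lambda>x.
     ((v$i powr \<alpha> * (\<Sum>j\<in>UNIV. A$i$j * (d j * x$j)) + d i * x$i * den v i) * Hfun A \<alpha> v
     - v$i powr \<alpha> * den v i * (2 * (\<Sum>j\<in>UNIV. d j * x$j * den v j))) / (Hfun A \<alpha> v * Hfun A \<alpha> v))"
  proof (rule frechet_derivative_unique_within[OF F E])
    \<comment> \<open>Positive steps along an axis stay in the orthant, so the derivative is unique
      even at boundary points.\<close>
    fix b :: "real^'n" and e :: real assume "b \<in> Basis" "0 < e"
    then show "\<exists>t. 0 < \<bar>t\<bar> \<and> \<bar>t\<bar> < e \<and> v + t *\<^sub>R b \<in> orthant"
      using orth by (intro exI[of _ "e/2"]) (auto simp: Basis_vec_def axis_def)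
  qed
  from fun_cong[OF this, of x] show ?thesis by (simp add: add.commute)
qed

context
  fixes v :: "real^'n"
  assumes eq: "equilibrium A \<alpha> v"
begin

lemma eq_regular: "regular v"
  using eq unfolding equilibrium_def by (intro regular_Delta) simp

lemma eq_fixed: "pifun A \<alpha> v = v"
  using eq unfolding equilibrium_def Ffun_def by (simp add: add_eq_0_iff)

lemma eq_orthant: "v \<in> orthant" and eq_sum: "(\<Sum>i\<in>UNIV. v$i) = 1"
  using eq unfolding equilibrium_def Delta_def by auto

lemma eq_le_1: "v$i \<le> 1"
  using member_le_sum[of i UNIV "\<lambda>i. v$i"] eq_orthant eq_sum by auto

lemma eq_weight_ge_1: "1 \<le> eq_weight v i"
  using eq_orthant eq_le_1[of i] unfolding eq_weight_def by (auto simp: order_less_le)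

lemma eq_weight_pos: "0 < eq_weight v i"
  using eq_weight_ge_1[of i] by linarith

text \<open>The fixed point equation says
  \<open>v $ i powr \<alpha> * den v i = v $ i * Hfun A \<alpha> v\<close>, which removes every
  \<open>den\<close> from the quotient rule. The second claim places the range of \<open>D\<close>
  in the tangent space.\<close>

lemma eq_derivative_component:
  assumes D: "(pifun A \<alpha> has_derivative D) (at v within orthant)"
  defines "d \<equiv> \<lambda>i. \<alpha> * v$i powr (\<alpha> - 1)"
    and "s \<equiv> \<lambda>i. of_bool (v$i \<noteq> 0)"
  shows "D x $ i = \<alpha> * s i * x$i + d i * v$i * (\<Sum>j\<in>UNIV. A$i$j * (d j * x$j)) / (\<alpha> * Hfun A \<alpha> v)
     - 2 * \<alpha> * v$i * (\<Sum>j\<in>UNIV. s j * x$j)"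
    and "(\<Sum>i\<in>UNIV. D x $ i) = 0"
proof -
  let ?H = "Hfun A \<alpha> v"
  have H: "0 < ?H" by (rule Hfun_pos[OF eq_regular])
  have v0: "0 \<le> v$i" for i using eq_orthant by simp
  have fp: "v$i powr \<alpha> * den v i = v$i * ?H" for i
    using arg_cong[OF eq_fixed, of "\<lambda>u. u$i"] H by (simp add: pifun_den field_simps)
  have dv: "v$i powr \<alpha> = d i * v$i / \<alpha>" for i
    unfolding d_def using alpha v0[of i] by (simp add: powr_mult_base mult_ac)
  have dQ: "d i * den v i = \<alpha> * s i * ?H" for i
  proof (cases "v$i = 0")
    case False
    have "d i * den v i * v$i = \<alpha> * (v$i powr \<alpha> * den v i)" unfolding dv using alpha by simp
    then have "(d i * den v i) * v$i = (\<alpha> * ?H) * v$i" unfolding fp by simp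
    then show ?thesis using False by (simp add: s_def)
  qed (simp add: d_def s_def)
  have "d j * x$j * den v j = \<alpha> * ?H * (s j * x$j)" for j
    using dQ[of j] by (simp add: mult_ac)
  then have S: "(\<Sum>j\<in>UNIV. d j * x$j * den v j) = \<alpha> * ?H * (\<Sum>j\<in>UNIV. s j * x$j)"
    unfolding sum_distrib_left by (intro sum.cong refl)
  let ?E = "\<lambda>i. \<Sum>j\<in>UNIV. A$i$j * (d j * x$j)"
  have ex: "D x $ i = ((d i * x$i * den v i + v$i powr \<alpha> * ?E i) * ?H
     - v$i powr \<alpha> * den v i * (2 * (\<Sum>j\<in>UNIV. d j * x$j * den v j))) / (?H * ?H)" for i
    unfolding d_def by (rule pifun_derivative_explicit[OF eq_regular D])
  have ex2: "D x $ i = (\<alpha> * s i * ?H * x$i + v$i powr \<alpha> * ?E i) / ?H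
     - 2 * \<alpha> * v$i * (\<Sum>j\<in>UNIV. s j * x$j)" for i
  proof -
    have "d i * x$i * den v i = \<alpha> * s i * ?H * x$i" using dQ[of i] by (simp add: mult_ac)
    then have "D x $ i = ((\<alpha> * s i * ?H * x$i + v$i powr \<alpha> * ?E i) * ?H
      - v$i * ?H * (2 * (\<alpha> * ?H * (\<Sum>j\<in>UNIV. s j * x$j)))) / (?H * ?H)"
      unfolding ex S fp by simp
    also have "\<dots> = ((\<alpha> * s i * ?H * x$i + v$i powr \<alpha> * ?E i) * ?H) / (?H * ?H)
      - (2 * \<alpha> * v$i * (\<Sum>j\<in>UNIV. s j * x$j)) * (?H * ?H) / (?H * ?H)"
      by (simp only: diff_divide_distrib) (simp only: mult_ac)
    finally show ?thesis using H by simp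
  qed
  show "D x $ i = \<alpha> * s i * x$i + d i * v$i * ?E i / (\<alpha> * ?H)
     - 2 * \<alpha> * v$i * (\<Sum>j\<in>UNIV. s j * x$j)"
    unfolding ex2 dv[of i] using H alpha by (simp add: add_divide_distrib)
  have "(\<Sum>i\<in>UNIV. v$i powr \<alpha> * ?E i) = (\<Sum>j\<in>UNIV. \<Sum>i\<in>UNIV. v$i powr \<alpha> * (A$i$j * (d j * x$j)))"
    unfolding sum_distrib_left by (rule sum.swap)
  also have "\<dots> = (\<Sum>j\<in>UNIV. d j * x$j * den v j)"
    unfolding den_def sum_distrib_left by (intro sum.cong refl) (simp add: A_sym mult_ac)
  finally have "(\<Sum>i\<in>UNIV. v$i powr \<alpha> * ?E i) = \<alpha> * ?H * (\<Sum>j\<in>UNIV. s j * x$j)" using S by simp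
  moreover have "(\<Sum>i\<in>UNIV. \<alpha> * s i * ?H * x$i) = \<alpha> * ?H * (\<Sum>j\<in>UNIV. s j * x$j)"
    by (simp add: sum_distrib_left mult_ac)
  moreover have "(\<Sum>i\<in>UNIV. 2 * \<alpha> * v$i * (\<Sum>j\<in>UNIV. s j * x$j)) = 2 * \<alpha> * (\<Sum>j\<in>UNIV. s j * x$j)"
    using eq_sum by (simp flip: sum_distrib_left sum_distrib_right)
  ultimately show "(\<Sum>i\<in>UNIV. D x $ i) = 0"
    unfolding ex2 using H by (simp add: sum_subtractf sum.distrib flip: sum_divide_distrib)
qed

text \<open>The weight turns the factor \<open>v $ i\<close> of row \<open>i\<close> into the
  indicator \<open>s i\<close> of the support. The three parts of \<open>D\<close> become a diagonal
  form, a form with the symmetric matrix \<open>A\<close>, and the product of one linear functional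
  at \<open>x\<close> and at \<open>y\<close>. Off the support the rows of \<open>D\<close> vanish,
  so the weight there only has to be positive.\<close>

lemma eq_derivative_selfadjoint:
  assumes D: "(pifun A \<alpha> has_derivative D) (at v within orthant)"
  shows "wdot (eq_weight v) y (D x) = wdot (eq_weight v) x (D y)"
proof -
  define d where "d = (\<lambda>i. \<alpha> * v$i powr (\<alpha> - 1))"
  define s :: "'n \<Rightarrow> real" where "s = (\<lambda>i. of_bool (v$i \<noteq> 0))"
  let ?H = "Hfun A \<alpha> v" and ?om = "eq_weight v"
  have om: "?om i * v$i = s i" and sd: "s i * d i = d i" for i
    by (auto simp: eq_weight_def s_def d_def)
  have "wdot ?om y (D x) = \<alpha> * (\<Sum>i\<in>UNIV. ?om i * s i * x$i * y$i)
     + (\<Sum>i\<in>UNIV. \<Sum>j\<in>UNIV. A$i$j * (d i * y$i) * (d j * x$j)) / (\<alpha> * ?H)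
     - 2 * \<alpha> * (\<Sum>i\<in>UNIV. s i * y$i) * (\<Sum>j\<in>UNIV. s j * x$j)" for x y
  proof -
    let ?E = "\<lambda>i. \<Sum>j\<in>UNIV. A$i$j * (d j * x$j)"
    have comp: "D x $ i = \<alpha> * s i * x$i + d i * v$i * ?E i / (\<alpha> * ?H)
      - 2 * \<alpha> * v$i * (\<Sum>j\<in>UNIV. s j * x$j)" for i
      unfolding d_def s_def by (rule eq_derivative_component(1)[OF D])
    have alg: "m * b * (\<alpha> * t * a + g * u * E / h - 2 * \<alpha> * u * T) =
      \<alpha> * (m * t * a * b) + (m * u) * g * b * E / h - 2 * \<alpha> * ((m * u) * b) * T"
      for m b t a g u E h T :: real by (simp add: algebra_simps)
    have "wdot ?om y (D x) = (\<Sum>i\<in>UNIV. \<alpha> * (?om i * s i * x$i * y$i)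
      + (d i * y$i) * ?E i / (\<alpha> * ?H) - 2 * \<alpha> * (s i * y$i) * (\<Sum>j\<in>UNIV. s j * x$j))"
      unfolding wdot_def
    proof (intro sum.cong refl)
      fix i
      have "?om i * y$i * D x $ i = \<alpha> * (?om i * s i * x$i * y$i) +
          (?om i * v$i) * d i * y$i * ?E i / (\<alpha> * ?H) - 2 * \<alpha> * ((?om i * v$i) * y$i) * (\<Sum>j\<in>UNIV. s j * x$j)"
        unfolding comp by (rule alg)
      then show "?om i * y$i * D x $ i = \<alpha> * (?om i * s i * x$i * y$i)
        + (d i * y$i) * ?E i / (\<alpha> * ?H) - 2 * \<alpha> * (s i * y$i) * (\<Sum>j\<in>UNIV. s j * x$j)"
        unfolding om sd .
    qed
    also have "\<dots> = \<alpha> * (\<Sum>i\<in>UNIV. ?om i * s i * x$i * y$i)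
      + (\<Sum>i\<in>UNIV. (d i * y$i) * ?E i) / (\<alpha> * ?H) - 2 * \<alpha> * (\<Sum>i\<in>UNIV. s i * y$i) * (\<Sum>j\<in>UNIV. s j * x$j)"
      unfolding sum.distrib sum_subtractf
      by (simp only: sum_distrib_left[symmetric] sum_distrib_right[symmetric] sum_divide_distrib[symmetric])
    finally show ?thesis unfolding sum_distrib_left by (simp add: mult_ac)
  qed
  note form = this
  have "(\<Sum>i\<in>UNIV. \<Sum>j\<in>UNIV. A$i$j * (d i * y$i) * (d j * x$j)) =
    (\<Sum>i\<in>UNIV. \<Sum>j\<in>UNIV. A$i$j * (d i * x$i) * (d j * y$j))"
    by (subst sum.swap) (auto intro!: sum.cong simp: A_sym mult_ac)
  then show ?thesis unfolding form by (simp add: mult_ac)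
qed

end

lemma linearly_stable_equilibrium: "linearly_stable A \<alpha> v \<Longrightarrow> equilibrium A \<alpha> v"
  by (simp add: linearly_stable_def)

lemma linearly_stable_contraction:
  assumes stable: "linearly_stable A \<alpha> v"
  obtains c r where "0 < c" "0 < r"
    "\<And>w. w \<in> orthant \<Longrightarrow> norm (w - v) \<le> r \<Longrightarrow>
       wdot (eq_weight v) (w - v) (Ffun A \<alpha> w) \<le> - c * wdot (eq_weight v) (w - v) (w - v)"
proof -
  have eq: "equilibrium A \<alpha> v" by (rule linearly_stable_equilibrium[OF stable])
  let ?om = "eq_weight v"
  note om = eq_weight_pos[OF eq]
  obtain D where D: "(pifun A \<alpha> has_derivative D) (at v within orthant)"
    and neg: "\<And>mu. is_eigenvalue_on (\<lambda>x. - x + D x) tangent_space mu \<Longrightarrow> Re mu < 0"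
    using stable unfolding linearly_stable_def by blast
  have lin: "linear D" using has_derivative_linear[OF D] .
  obtain l x where x: "x \<noteq> 0" "D x = l *\<^sub>R x" and max: "\<And>y. wdot ?om y (D y) \<le> l * wdot ?om y y"
    using selfadjoint_max_eigenvector[of D ?om, OF lin om eq_derivative_selfadjoint[OF eq D]] by metis
  \<comment> \<open>If \<open>l\<close> is positive, \<open>x\<close> is a multiple of
    \<open>D x\<close> and hence tangent, so \<open>l - 1\<close> is a real eigenvalue of the
    differential of \<open>Ffun\<close>, with zero imaginary part of the eigenvector.\<close>
  have l: "l < 1"
  proof (cases "l \<le> 0")
    case False
    have "l * (\<Sum>i\<in>UNIV. x$i) = 0"
      using eq_derivative_component(2)[OF eq D, of x] x(2) by (simp flip: sum_distrib_left)
    then have "x \<in> tangent_space" using False by (simp add: tangent_space_def)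
    then have "is_eigenvalue_on (\<lambda>x. - x + D x) tangent_space (complex_of_real (l - 1))"
      unfolding is_eigenvalue_on_def using x linear_0[OF lin]
      by (intro exI[of _ x] exI[of _ 0]) (auto simp: tangent_space_def scaleR_left_diff_distrib)
    then show ?thesis using neg by fastforce
  qed simp
  \<comment> \<open>Half of the gap \<open>1 - l\<close> remains as contraction rate. The other half
    absorbs the first-order remainder of \<open>pifun\<close>, whose weighted pairing with
    \<open>w - v\<close> costs the total weight \<open>W\<close>.\<close>
  define c where "c = (1 - l) / 2"
  have c: "0 < c" using l by (simp add: c_def)
  define W where "W = (\<Sum>i\<in>UNIV. ?om i)"
  have W: "0 < W" unfolding W_def using om by (intro sum_pos) auto
  from D[unfolded has_derivative_within_alt] c W
  obtain r0 where r0: "0 < r0" and rem: "\<And>w. w \<in> orthant \<Longrightarrow> norm (w - v) < r0 \<Longrightarrow>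
      norm (pifun A \<alpha> w - pifun A \<alpha> v - D (w - v)) \<le> c / W * norm (w - v)"
    by (metis divide_pos_pos)
  show ?thesis
  proof (rule that[OF c])
    show "0 < r0 / 2" using r0 by simp
    fix w :: "real^'n" assume w: "w \<in> orthant" "norm (w - v) \<le> r0 / 2"
    define p where "p = w - v"
    define e where "e = pifun A \<alpha> w - v - D p"
    have e: "norm e \<le> c / W * norm p"
      using rem[of w] w r0 unfolding e_def p_def eq_fixed[OF eq] by simp
    have F: "Ffun A \<alpha> w = - 1 *\<^sub>R p + D p + e" unfolding Ffun_def e_def p_def by simp
    have np: "(norm p)\<^sup>2 \<le> wdot ?om p p" by (rule norm_le_wdot[OF eq_weight_ge_1[OF eq]])
    have "wdot ?om p e \<le> (\<Sum>i\<in>UNIV. ?om i * (norm p * norm e))"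
      unfolding wdot_def mult.assoc
    proof (intro sum_mono mult_left_mono)
      fix i
      have "p$i * e$i \<le> \<bar>p$i\<bar> * \<bar>e$i\<bar>" by (metis abs_ge_self abs_mult)
      also have "\<dots> \<le> norm p * norm e" by (intro mult_mono component_le_norm_cart) auto
      finally show "p$i * e$i \<le> norm p * norm e" .
    qed (use om less_imp_le in blast)
    also have "\<dots> = W * (norm p * norm e)" by (simp add: W_def sum_distrib_right)
    also have "\<dots> \<le> W * (norm p * (c / W * norm p))"
      using W e by (intro mult_left_mono) auto
    also have "\<dots> = c * (norm p)\<^sup>2" using W by (simp add: power2_eq_square)
    also have "\<dots> \<le> c * wdot ?om p p" using np c by simp
    finally have "wdot ?om p e \<le> c * wdot ?om p p" .
    moreover have "wdot ?om p (D p) \<le> l * wdot ?om p p" by (rule max)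
    ultimately have "wdot ?om p (Ffun A \<alpha> w) \<le> - wdot ?om p p + l * wdot ?om p p + c * wdot ?om p p"
      unfolding F wdot_simps by simp
    also have "\<dots> = - c * wdot ?om p p" unfolding c_def by (simp add: field_simps)
    finally show "wdot ?om (w - v) (Ffun A \<alpha> w) \<le> - c * wdot ?om (w - v) (w - v)" unfolding p_def .
  qed
qed

end

subsection \<open>The corrected Lyapunov function\<close>

lemma lip_at_uniform:
  fixes f :: "'b::finite \<Rightarrow> 'a::real_normed_vector \<Rightarrow> real"
  assumes "\<And>k. lip_at S a (f k)" "a \<in> S"
  obtains L r where "0 \<le> L" "0 < r"
    "\<And>k x y. x \<in> S \<Longrightarrow> y \<in> S \<Longrightarrow> norm (x - a) \<le> r \<Longrightarrow> norm (y - a) \<le> r \<Longrightarrow>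
      \<bar>f k x - f k y\<bar> \<le> L * norm (x - y)"
    "\<And>k x. x \<in> S \<Longrightarrow> norm (x - a) \<le> r \<Longrightarrow> \<bar>f k x - f k a\<bar> \<le> 1"
proof -
  define Q where "Q = (\<lambda>k L. 0 \<le> L \<and> (\<forall>\<^sub>F r in at_right 0. \<forall>x\<in>S. \<forall>y\<in>S. norm (x - a) \<le> r \<longrightarrow>
    norm (y - a) \<le> r \<longrightarrow> \<bar>f k x - f k y\<bar> \<le> L * norm (x - y)))"
  have "\<exists>L. Q k L" for k
    by (rule lip_atE[OF assms(1)[of k]]) (unfold Q_def, blast)
  then obtain L where "\<And>k. Q k (L k)" by metis
  then have L: "\<And>k. 0 \<le> L k" "\<And>k. \<forall>\<^sub>F r in at_right 0. \<forall>x\<in>S. \<forall>y\<in>S. norm (x - a) \<le> r \<longrightarrow>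
    norm (y - a) \<le> r \<longrightarrow> \<bar>f k x - f k y\<bar> \<le> L k * norm (x - y)"
    unfolding Q_def by blast+
  define P where "P = (\<lambda>r. 0 < r \<and>
    (\<forall>k. \<forall>x\<in>S. \<forall>y\<in>S. norm (x - a) \<le> r \<longrightarrow> norm (y - a) \<le> r \<longrightarrow> \<bar>f k x - f k y\<bar> \<le> L k * norm (x - y)) \<and>
    (\<forall>k. \<forall>x\<in>S. norm (x - a) \<le> r \<longrightarrow> \<bar>f k x - f k a\<bar> < 1))"
  have "\<forall>\<^sub>F r in at_right 0. P r"
    unfolding P_def
  proof (intro eventually_conj)
    show "\<forall>\<^sub>F r in at_right (0::real). 0 < r" by (rule eventually_at_right_less)
  qed (rule eventually_all_finite, rule L(2) lip_at_near[OF assms zero_less_one])+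
  then obtain r where "P r"
    using eventually_happens' trivial_limit_at_right_real by blast
  then have r: "0 < r" "\<And>k x y. x \<in> S \<Longrightarrow> y \<in> S \<Longrightarrow> norm (x - a) \<le> r \<Longrightarrow> norm (y - a) \<le> r \<Longrightarrow>
      \<bar>f k x - f k y\<bar> \<le> L k * norm (x - y)"
    "\<And>k x. x \<in> S \<Longrightarrow> norm (x - a) \<le> r \<Longrightarrow> \<bar>f k x - f k a\<bar> < 1"
    unfolding P_def by blast+
  have Lsum: "L k \<le> (\<Sum>k\<in>UNIV. L k)" for k
    using L(1) by (intro member_le_sum) auto
  show ?thesis
  proof (rule that[of "\<Sum>k\<in>UNIV. L k" r])
    fix k x y assume "x \<in> S" "y \<in> S" "norm (x - a) \<le> r" "norm (y - a) \<le> r"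
    then have "\<bar>f k x - f k y\<bar> \<le> L k * norm (x - y)" by (rule r(2))
    also have "\<dots> \<le> (\<Sum>k\<in>UNIV. L k) * norm (x - y)" by (intro mult_right_mono Lsum) simp
    finally show "\<bar>f k x - f k y\<bar> \<le> (\<Sum>k\<in>UNIV. L k) * norm (x - y)" .
  next
    show "0 \<le> (\<Sum>k\<in>UNIV. L k)" using L(1) by (intro sum_nonneg)
    show "0 < r" by (rule r(1))
    show "\<bar>f k x - f k a\<bar> \<le> 1" if "x \<in> S" "norm (x - a) \<le> r" for k x
      using r(3)[OF that, of k] by simp
  qed
qed

lemma wdot_le_norm:
  assumes "\<And>i. 0 \<le> om i"
  shows "wdot om x x \<le> (\<Sum>i\<in>UNIV. om i) * (norm x)\<^sup>2"
  unfolding wdot_def sum_distrib_right mult.assoc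
proof (intro sum_mono mult_left_mono)
  fix i
  have "x$i * x$i = \<bar>x$i\<bar> * \<bar>x$i\<bar>" by simp
  also have "\<dots> \<le> norm x * norm x" by (intro mult_mono component_le_norm_cart) auto
  finally show "x$i * x$i \<le> (norm x)\<^sup>2" by (simp add: power2_eq_square)
qed (rule assms)

context reinforcement
begin

definition lyap :: "real^'n \<Rightarrow> real^'n \<Rightarrow> real" where
  "lyap v w = wdot (eq_weight v) (w - v) (w - v)"

text \<open>The gradient of \<open>lyap v\<close> at \<open>w\<close> applied to the corrector. It
  vanishes at \<open>w = v\<close>, whence the bound 1 near \<open>v\<close>.\<close>

definition lyap_corr :: "real^'n \<Rightarrow> real^'n \<Rightarrow> 'n \<Rightarrow> real" where
  "lyap_corr v w x = 2 * wdot (eq_weight v) (w - v) (\<chi> i. corrector w x i)"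

definition advance :: "real^'n \<Rightarrow> real \<Rightarrow> 'n \<Rightarrow> real^'n" where
  "advance w s y = w + s *\<^sub>R (axis y 1 - w)"

text \<open>Split the increment into the noise \<open>axis y 1 - pifun A \<alpha> w\<close> and
  \<open>Ffun A \<alpha> w\<close>. The mean of the noise is a difference of correctors, so adding
  the corrector after the step leaves only its present value.\<close>

lemma mean_drift:
  assumes reg: "regular w"
  shows "(\<Sum>y\<in>UNIV. kern w x y * (2 * wdot (eq_weight v) (w - v) (axis y 1 - w) + lyap_corr v w y)) =
    2 * wdot (eq_weight v) (w - v) (Ffun A \<alpha> w) + lyap_corr v w x"
proof -
  let ?om = "eq_weight v" and ?p = "w - v"
  have step: "(\<Sum>y\<in>UNIV. kern w x y * ((axis y 1 - w) $ i + corrector w y i)) = Ffun A \<alpha> w $ i + corrector w x i" for i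
  proof -
    have "(\<Sum>y\<in>UNIV. kern w x y * ((axis y 1 - w) $ i + corrector w y i)) =
      (\<Sum>y\<in>UNIV. kern w x y * ((if y = i then 1 else 0) - pifun A \<alpha> w $ i)
         + kern w x y * (pifun A \<alpha> w $ i - w$i) + kern w x y * corrector w y i)"
      by (intro sum.cong refl) (auto simp: axis_def algebra_simps)
    also have "\<dots> = corrector w x i + (pifun A \<alpha> w $ i - w$i)"
      unfolding sum.distrib kern_corrector[OF reg]
      by (simp add: sum_kern[OF reg] flip: sum_distrib_right)
    finally show ?thesis by (simp add: Ffun_def)
  qed
  have "(\<Sum>y\<in>UNIV. kern w x y * (2 * wdot ?om ?p (axis y 1 - w) + lyap_corr v w y)) =
    (\<Sum>y\<in>UNIV. \<Sum>i\<in>UNIV. 2 * (?om i * ?p$i) * (kern w x y * ((axis y 1 - w) $ i + corrector w y i)))"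
    unfolding lyap_corr_def wdot_def vec_lambda_beta sum_distrib_left sum.distrib[symmetric]
    by (intro sum.cong refl) (simp add: algebra_simps)
  also have "\<dots> = (\<Sum>i\<in>UNIV. 2 * (?om i * ?p$i) * (Ffun A \<alpha> w $ i + corrector w x i))"
    unfolding step[symmetric] sum_distrib_left by (rule sum.swap)
  also have "\<dots> = 2 * wdot ?om ?p (Ffun A \<alpha> w) + lyap_corr v w x"
    unfolding lyap_corr_def wdot_def vec_lambda_beta sum_distrib_left sum.distrib[symmetric]
    by (intro sum.cong refl) (simp add: algebra_simps)
  finally show ?thesis .
qed

lemma lyap_advance:
  "lyap v (advance w s y) = lyap v w + s * (2 * wdot (eq_weight v) (w - v) (axis y 1 - w))
     + s\<^sup>2 * wdot (eq_weight v) (axis y 1 - w) (axis y 1 - w)"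
proof -
  let ?q = "axis y 1 - w :: real^'n" and ?p = "w - v"
  have "advance w s y - v = ?p + s *\<^sub>R ?q" by (simp add: advance_def)
  then have "lyap v (advance w s y) = wdot (eq_weight v) (?p + s *\<^sub>R ?q) (?p + s *\<^sub>R ?q)"
    by (simp only: lyap_def)
  also have "\<dots> = wdot (eq_weight v) ?p ?p + s * (2 * wdot (eq_weight v) ?p ?q) + s\<^sup>2 * wdot (eq_weight v) ?q ?q"
    unfolding wdot_add_left wdot_add_right wdot_scale_left wdot_scale_right
    using wdot_commute[of "eq_weight v" ?p ?q] by (simp only: power2_eq_square) (simp only: algebra_simps)
  finally show ?thesis by (simp add: lyap_def)
qed

lemma advance_orthant:
  assumes "w \<in> orthant" "0 \<le> s" "s \<le> 1"
  shows "advance w s y \<in> orthant"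
proof -
  have "0 \<le> (1 - s) * w$i + s * axis y 1 $ i" for i
    using assms by (intro add_nonneg_nonneg mult_nonneg_nonneg) (auto simp: axis_def)
  then show ?thesis by (simp add: advance_def algebra_simps)
qed

text \<open>Here \<open>s\<close> and \<open>s'\<close> are two consecutive step sizes. Mean drift
  and contraction give the main terms; all other contributions are of order
  \<open>s\<^sup>2\<close>.\<close>

lemma lyap_one_step:
  assumes stable: "linearly_stable A \<alpha> v"
  obtains R c r C s0 where "0 < c" "0 < r" "0 < C" "0 < s0" "\<And>w x. \<bar>R w x\<bar> \<le> 1"
    "\<And>w x s s'. regular w \<Longrightarrow> norm (w - v) \<le> r \<Longrightarrow> 0 < s \<Longrightarrow> s \<le> s0 \<Longrightarrow> 0 \<le> s' \<Longrightarrow> s' \<le> s \<Longrightarrow> s - s' \<le> s\<^sup>2 \<Longrightarrow>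
      (\<Sum>y\<in>UNIV. kern w x y * (lyap v (advance w s y) + s' * R (advance w s y) y))
        \<le> lyap v w + s * R w x - c * s * lyap v w + C * s\<^sup>2"
proof -
  have eq: "equilibrium A \<alpha> v" by (rule linearly_stable_equilibrium[OF stable])
  note reg_v = eq_regular[OF eq] and orth_v = eq_orthant[OF eq]
  let ?om = "eq_weight v"
  have om: "0 \<le> ?om i" for i using eq_weight_pos[OF eq, of i] by simp
  obtain c r1 where c: "0 < c" and r1: "0 < r1" and contr: "\<And>w. w \<in> orthant \<Longrightarrow> norm (w - v) \<le> r1 \<Longrightarrow>
       wdot ?om (w - v) (Ffun A \<alpha> w) \<le> - c * wdot ?om (w - v) (w - v)"
    using linearly_stable_contraction[OF stable] by metis
  have "lip_at orthant v (\<lambda>w. lyap_corr v w x)" for x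
    unfolding lyap_corr_def wdot_def vec_lambda_beta vector_minus_component
    by (intro lip_at_mult lip_at_sum lip_at_diff lip_at_const lip_at_nth lip_at_corrector orth_v reg_v)
  then obtain L r2 where L: "0 \<le> L" "0 < r2"
    "\<And>x w w'. w \<in> orthant \<Longrightarrow> w' \<in> orthant \<Longrightarrow> norm (w - v) \<le> r2 \<Longrightarrow> norm (w' - v) \<le> r2 \<Longrightarrow>
      \<bar>lyap_corr v w x - lyap_corr v w' x\<bar> \<le> L * norm (w - w')"
    and corr_v: "\<And>x w. w \<in> orthant \<Longrightarrow> norm (w - v) \<le> r2 \<Longrightarrow> \<bar>lyap_corr v w x - lyap_corr v v x\<bar> \<le> 1"
    using lip_at_uniform[of orthant v "\<lambda>x w. lyap_corr v w x"] orth_v by blast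
  have corr_1: "\<bar>lyap_corr v w x\<bar> \<le> 1" if "w \<in> orthant" "norm (w - v) \<le> r2" for w x
    using corr_v[OF that, of x] by (simp add: lyap_corr_def wdot_def)
  \<comment> \<open>The cut-off makes the correction bounded everywhere, so that the corrected
    function can be compared with \<open>lyap\<close> along all paths and not only near
    \<open>v\<close>.\<close>
  define R where "R = (\<lambda>w x. if w \<in> orthant \<and> norm (w - v) \<le> r2 then lyap_corr v w x else 0)"
  define r where "r = min r1 (r2 / 2)"
  define K where "K = 1 + norm v + r"
  define W where "W = (\<Sum>i\<in>UNIV. ?om i)"
  have r: "0 < r" "r \<le> r1" "2 * r \<le> r2" using r1 L(2) by (auto simp: r_def)
  have K: "0 < K" using r by (simp add: K_def add_pos_nonneg add_nonneg_pos)
  have W: "0 \<le> W" unfolding W_def using om by (intro sum_nonneg)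
  \<comment> \<open>The summands bound the quadratic term of \<open>lyap\<close>, the change of the
    corrector when \<open>w\<close> moves by at most \<open>s * K\<close>, and the change of its
    coefficient from \<open>s\<close> to \<open>s'\<close>.\<close>
  define C where "C = W * K\<^sup>2 + L * K + 1"
  have C: "0 < C" unfolding C_def using W K L(1) by (intro add_nonneg_pos add_nonneg_nonneg mult_nonneg_nonneg) auto
  \<comment> \<open>A step of size at most 1 is a convex combination, and one of length at most
    \<open>r\<close> from within radius \<open>r\<close> stays within \<open>r2\<close>, where the
    cut-off is inactive.\<close>
  define s0 where "s0 = min 1 (r / K)"
  have s0: "0 < s0" using r K by (simp add: s0_def)
  show ?thesis
  proof (rule that[of "2 * c" r C s0 R])
    show "\<bar>R w x\<bar> \<le> 1" for w x using corr_1 by (simp add: R_def)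
    fix w x s s'
    assume reg: "regular w" and near: "norm (w - v) \<le> r" and s: "0 < s" "s \<le> s0" "0 \<le> s'" "s' \<le> s" "s - s' \<le> s\<^sup>2"
    have orth: "w \<in> orthant" using reg by (simp add: regular_def)
    have s1: "s \<le> 1" "s * K \<le> r" using s K by (auto simp: s0_def field_simps)
    have q: "norm (axis y 1 - w) \<le> K" for y
    proof -
      have "norm (axis y 1 - w) \<le> norm (axis y (1::real) :: real^'n) + norm w" by (rule norm_triangle_ineq4)
      also have "norm w \<le> norm v + norm (w - v)" by (rule norm_triangle_sub)
      finally show ?thesis using near by (simp add: K_def norm_axis_1)
    qed
    have n: "norm (w - v) \<le> r2" using near r by linarith
    have Rw: "R w x = lyap_corr v w x" using orth n by (simp add: R_def)
    have bnd: "lyap v (advance w s y) + s' * R (advance w s y) y \<le>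
      lyap v w + s * (2 * wdot ?om (w - v) (axis y 1 - w) + lyap_corr v w y) + C * s\<^sup>2" for y
    proof -
      let ?w' = "advance w s y"
      have w': "?w' \<in> orthant" using orth s s1 by (intro advance_orthant) auto
      have d: "norm (?w' - w) \<le> s * K" using q[of y] s by (simp add: advance_def)
      have "norm (?w' - v) \<le> norm (?w' - w) + norm (w - v)" by (rule norm_diff_triangle_ineq[of ?w' w w v, simplified])
      then have n': "norm (?w' - v) \<le> r2" using d near s1 r by linarith
      have Rw': "R ?w' y = lyap_corr v ?w' y" using w' n' by (simp add: R_def)
      have "s' * (lyap_corr v ?w' y - lyap_corr v w y) \<le> s * (L * (s * K))"
      proof -
        have "s' * (lyap_corr v ?w' y - lyap_corr v w y) \<le> s' * \<bar>lyap_corr v ?w' y - lyap_corr v w y\<bar>"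
          using s by (intro mult_left_mono) auto
        also have "\<dots> \<le> s * (L * (s * K))"
          using s L(1) d order_trans[OF L(3)[OF w' orth n' n] mult_left_mono[OF d L(1)]]
          by (intro mult_mono) auto
        finally show ?thesis .
      qed
      moreover have "(s' - s) * lyap_corr v w y \<le> s\<^sup>2"
      proof -
        have "(s' - s) * lyap_corr v w y \<le> \<bar>s' - s\<bar> * \<bar>lyap_corr v w y\<bar>" by (metis abs_ge_self abs_mult)
        also have "\<dots> \<le> s\<^sup>2 * 1" using s corr_1[OF orth n, of y] by (intro mult_mono) auto
        finally show ?thesis by simp
      qed
      moreover have "s\<^sup>2 * wdot ?om (axis y 1 - w) (axis y 1 - w) \<le> s\<^sup>2 * (W * K\<^sup>2)"
      proof (intro mult_left_mono)
        have "wdot ?om (axis y 1 - w) (axis y 1 - w) \<le> W * (norm (axis y 1 - w))\<^sup>2"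
          unfolding W_def by (rule wdot_le_norm[OF om])
        also have "\<dots> \<le> W * K\<^sup>2" using W q[of y] by (intro mult_left_mono power_mono) auto
        finally show "wdot ?om (axis y 1 - w) (axis y 1 - w) \<le> W * K\<^sup>2" .
      qed simp
      ultimately show ?thesis unfolding Rw' lyap_advance C_def
        by (simp add: algebra_simps power2_eq_square)
    qed
    have "(\<Sum>y\<in>UNIV. kern w x y * (lyap v (advance w s y) + s' * R (advance w s y) y)) \<le>
      (\<Sum>y\<in>UNIV. kern w x y * (lyap v w + s * (2 * wdot ?om (w - v) (axis y 1 - w) + lyap_corr v w y) + C * s\<^sup>2))"
      by (intro sum_mono mult_left_mono bnd kern_nonneg[OF reg])
    also have "\<dots> = (\<Sum>y\<in>UNIV. kern w x y * (lyap v w + C * s\<^sup>2)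
       + s * (kern w x y * (2 * wdot ?om (w - v) (axis y 1 - w) + lyap_corr v w y)))"
      by (intro sum.cong refl) (simp add: algebra_simps)
    also have "\<dots> = lyap v w + C * s\<^sup>2 + s * (2 * wdot ?om (w - v) (Ffun A \<alpha> w) + lyap_corr v w x)"
      unfolding sum.distrib sum_distrib_left[symmetric] sum_distrib_right[symmetric] mean_drift[OF reg] sum_kern[OF reg]
      by simp
    also have "\<dots> \<le> lyap v w + C * s\<^sup>2 + s * (2 * (- c * lyap v w) + lyap_corr v w x)"
      using contr[OF orth] near r s C unfolding lyap_def by (intro add_mono mult_left_mono) auto
    finally show "(\<Sum>y\<in>UNIV. kern w x y * (lyap v (advance w s y) + s' * R (advance w s y) y))
        \<le> lyap v w + s * R w x - 2 * c * s * lyap v w + C * s\<^sup>2"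
      unfolding Rw by (simp add: algebra_simps)
  qed (use c r C s0 in auto)
qed

end

subsection \<open>Occupation frequencies and an admissible path to the equilibrium\<close>

lemma exists_le_weighted_mean:
  fixes k f :: "'a::finite \<Rightarrow> real"
  assumes k: "\<And>y. 0 \<le> k y" "(\<Sum>y\<in>UNIV. k y) = 1" and m: "(\<Sum>y\<in>UNIV. k y * f y) \<le> m"
  obtains y where "0 < k y" "f y \<le> m"
proof (rule ccontr)
  assume "\<not> thesis"
  then have gt: "m < f y" if "0 < k y" for y using that \<open>\<And>y. \<lbrakk>0 < k y; f y \<le> m\<rbrakk> \<Longrightarrow> thesis\<close> by force
  obtain z where z: "0 < k z"
    using k by (metis less_le sum.neutral zero_neq_one)
  have "0 < (\<Sum>y\<in>UNIV. k y * (f y - m))"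
  proof (rule sum_pos2[of UNIV z])
    show "0 < k z * (f z - m)" using z gt by simp
    show "0 \<le> k y * (f y - m)" for y
      using gt[of y] k(1)[of y] by (cases "k y = 0") (auto simp: less_le)
  qed auto
  also have "\<dots> = (\<Sum>y\<in>UNIV. k y * f y) - m"
    using k(2) by (simp add: right_diff_distrib sum_subtractf flip: sum_distrib_right)
  finally show False using m by simp
qed

lemma visits_0: "visits h 0 j = (if h 0 = j then 1 else 0)"
proof -
  have "{l. l \<le> 0 \<and> h l = j} = (if h 0 = j then {0} else {})" by auto
  then show ?thesis by (simp add: visits_def)
qed

lemma visits_Suc: "visits h (Suc n) j = visits h n j + (if h (Suc n) = j then 1 else 0)"
proof -
  have fin: "finite {l. l \<le> n \<and> h l = j}" by (rule finite_subset[of _ "{..n}"]) auto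
  have "{l. l \<le> Suc n \<and> h l = j} = (if h (Suc n) = j then insert (Suc n) {l. l \<le> n \<and> h l = j} else {l. l \<le> n \<and> h l = j})"
    by (auto simp: le_Suc_eq)
  then show ?thesis using fin by (simp add: visits_def)
qed

lemma visits_cong:
  assumes "\<And>k. k \<le> n \<Longrightarrow> h k = h' k"
  shows "visits h n j = visits h' n j"
proof -
  have "{l. l \<le> n \<and> h l = j} = {l. l \<le> n \<and> h' l = j}" using assms by auto
  then show ?thesis by (simp add: visits_def)
qed

text \<open>The reciprocal of the denominator of \<open>smooth_occ\<close> at time
  \<open>Suc n\<close>; the type argument carries the number of states.\<close>

definition step_size :: "'n::finite itself \<Rightarrow> nat \<Rightarrow> real" where
  "step_size t n = 1 / (real n + 2 + real CARD('n))"

text \<open>The walk is driven by these smoothed frequencies: its transition probabilities are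
  homogeneous of degree 0 in \<open>1 + visits\<close>.\<close>
definition smooth_occ :: "(nat \<Rightarrow> 'n) \<Rightarrow> nat \<Rightarrow> real^'n" where
  "smooth_occ h n = (\<chi> i. (1 + real (visits h n i)) / (real n + 1 + real CARD('n)))"

lemma smooth_occ_pos: "0 < smooth_occ h n $ i"
  unfolding smooth_occ_def by (simp add: add_pos_nonneg)

lemma smooth_occ_cong: "(\<And>k. k \<le> n \<Longrightarrow> h k = h' k) \<Longrightarrow> smooth_occ h n = smooth_occ h' n"
  unfolding smooth_occ_def using visits_cong[of n h h'] by simp

context reinforcement
begin

lemma vrrw_trans_kern: "vrrw_trans A \<alpha> h n j = kern (smooth_occ h n) (h n) j"
proof -
  let ?c = "real n + 1 + real CARD('n)"
  have c: "0 < ?c" by (simp add: add_pos_nonneg)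
  have "(1 + real (visits h n k)) powr \<alpha> = ?c powr \<alpha> * smooth_occ h n $ k powr \<alpha>" for k
    using c by (simp add: smooth_occ_def powr_divide)
  then show ?thesis unfolding vrrw_trans_def kern_def den_def
    using c by (simp add: mult.left_commute[of _ "?c powr \<alpha>"] flip: sum_distrib_left)
qed

lemma smooth_occ_Suc:
  "smooth_occ (h(Suc n := y)) (Suc n) = advance (smooth_occ h n) (step_size TYPE('n) n) y"
proof -
  have v: "visits (h(Suc n := y)) (Suc n) i = visits h n i + (if y = i then 1 else 0)" for i
    using visits_cong[of n "h(Suc n := y)" h i] by (simp add: visits_Suc)
  let ?c = "real n + 1 + real CARD('n)"
  have c: "0 < ?c" by (simp add: add_pos_nonneg)
  have "(1 + z + e) / (?c + 1) = (1 + z) / ?c + 1 / (?c + 1) * (e - (1 + z) / ?c)" for z e :: real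
  proof -
    define c where "c = ?c"
    define q where "q = (1 + z) / c"
    have c: "0 < c" using c by (simp add: c_def)
    then have "1 + z = q * c" by (simp add: q_def)
    then have "(1 + z + e) / (c + 1) = q + 1 / (c + 1) * (e - q)"
      using c by (simp add: field_simps)
    then show ?thesis unfolding c_def[symmetric] q_def .
  qed
  note alg = this
  show ?thesis
    unfolding vec_eq_iff
  proof
    fix i
    let ?e = "if y = i then 1 else 0 :: real"
    have "smooth_occ (h(Suc n := y)) (Suc n) $ i = (1 + real (visits h n i) + ?e) / (?c + 1)"
      by (simp add: smooth_occ_def v add_ac)
    also have "\<dots> = smooth_occ h n $ i + 1 / (?c + 1) * (?e - smooth_occ h n $ i)"
      unfolding alg by (simp add: smooth_occ_def)
    also have "1 / (?c + 1) = step_size TYPE('n) n" by (simp add: step_size_def add_ac)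
    also have "smooth_occ h n $ i + step_size TYPE('n) n * (?e - smooth_occ h n $ i) =
        advance (smooth_occ h n) (step_size TYPE('n) n) y $ i"
      by (simp add: advance_def axis_def)
    finally show "smooth_occ (h(Suc n := y)) (Suc n) $ i = advance (smooth_occ h n) (step_size TYPE('n) n) y $ i" .
  qed
qed

text \<open>Derandomisation: with \<open>S\<close> the centred occupation counts of the chain \<open>kern v\<close>, the process
  \<open>S + corrector\<close> is a martingale with bounded increments, so some choice of the next state raises its
  squared norm by at most a constant; hence \<open>S\<close> grows at most like the square root of time.\<close>
lemma exists_path_to_equilibrium:
  fixes x0 :: 'n
  assumes eq: "equilibrium A \<alpha> v"
  obtains h where "h 0 = x0" "\<And>n. A $ h n $ h (Suc n) \<noteq> 0" "(\<lambda>n. smooth_occ h n) \<longlonglongrightarrow> v"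
proof -
  note reg = eq_regular[OF eq]
  define g where "g = (\<lambda>x. \<chi> i. green v x i)"
  define u where "u = (\<lambda>x. \<chi> i. corrector v x i)"
  have gu: "axis x 1 - v = g x - u x" for x
    unfolding vec_eq_iff
  proof
    fix i show "(axis x 1 - v) $ i = (g x - u x) $ i"
      using poisson[OF reg, of x i] by (cases "x = i") (auto simp: g_def u_def axis_def eq_fixed[OF eq])
  qed
  have mean: "(\<Sum>y\<in>UNIV. kern v x y *\<^sub>R g y) = u x" for x
    by (simp add: vec_eq_iff g_def u_def corrector_def)
  define C where "C = (\<Sum>x\<in>UNIV. \<Sum>y\<in>UNIV. kern v x y * (norm (g y - u x))\<^sup>2)"
  \<comment> \<open>By the Poisson equation the new vector is \<open>S + g y\<close>, and
    \<open>g y\<close> has mean \<open>u x\<close> under \<open>kern v x\<close>. The cross term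
    therefore vanishes and the mean squared norm grows by a variance, bounded by \<open>C\<close> at
    every state.\<close>
  have step: "\<exists>y. 0 < kern v x y \<and> (norm (S + axis y 1 - v + u y))\<^sup>2 \<le> (norm (S + u x))\<^sup>2 + C" for S x
  proof -
    have "(\<Sum>y\<in>UNIV. kern v x y * (norm (S + g y))\<^sup>2) = (\<Sum>y\<in>UNIV. kern v x y * (norm (S + u x))\<^sup>2
       + 2 * (inner (S + u x) (kern v x y *\<^sub>R g y) - kern v x y * inner (S + u x) (u x))
       + kern v x y * (norm (g y - u x))\<^sup>2)"
      unfolding power2_norm_eq_inner
      by (intro sum.cong refl) (simp add: inner_simps inner_commute algebra_simps)
    also have "\<dots> = (norm (S + u x))\<^sup>2 + (\<Sum>y\<in>UNIV. kern v x y * (norm (g y - u x))\<^sup>2)"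
      unfolding sum.distrib sum_subtractf sum_distrib_left[symmetric] sum_distrib_right[symmetric]
        inner_sum_right[symmetric] mean sum_kern[OF reg] by simp
    also have "\<dots> \<le> (norm (S + u x))\<^sup>2 + C"
      unfolding C_def by (intro add_left_mono member_le_sum sum_nonneg mult_nonneg_nonneg kern_nonneg[OF reg]) auto
    finally obtain y where y: "0 < kern v x y" "(norm (S + g y))\<^sup>2 \<le> (norm (S + u x))\<^sup>2 + C"
      by (rule exists_le_weighted_mean[of "kern v x" "\<lambda>y. (norm (S + g y))\<^sup>2",
          OF kern_nonneg[OF reg] sum_kern[OF reg]])
    have "S + axis y 1 - v + u y = S + g y" using gu[of y] by (simp add: algebra_simps)
    with y show ?thesis by metis
  qed
  have C: "0 \<le> C" unfolding C_def by (intro sum_nonneg mult_nonneg_nonneg kern_nonneg[OF reg]) auto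
  define C0 where "C0 = (norm (axis x0 1 - v + u x0))\<^sup>2"
  define P where "P = (\<lambda>n (S, x). (n = 0 \<longrightarrow> x = x0 \<and> S = axis x0 1 - v) \<and> (norm (S + u x))\<^sup>2 \<le> C0 + C * real n)"
  define Q where "Q = (\<lambda>(S, x) (S', y). 0 < kern v x y \<and> S' = S + axis y 1 - v)"
  have "\<exists>f. \<forall>n. P n (f n) \<and> Q (f n) (f (Suc n))"
  proof (rule dependent_nat_choice)
    show "\<exists>s. P 0 s" unfolding P_def C0_def by auto
    fix s n assume P: "P n s"
    obtain S x where s: "s = (S, x)" by force
    obtain y where y: "0 < kern v x y" "(norm (S + axis y 1 - v + u y))\<^sup>2 \<le> (norm (S + u x))\<^sup>2 + C"
      using step by blast
    have "(norm (S + u x))\<^sup>2 \<le> C0 + C * real n" using P by (simp add: P_def s)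
    then show "\<exists>s'. P (Suc n) s' \<and> Q s s'"
      using y by (intro exI[of _ "(S + axis y 1 - v, y)"]) (simp add: P_def Q_def s algebra_simps)
  qed
  then obtain f where f: "\<And>n. P n (f n)" "\<And>n. Q (f n) (f (Suc n))" by blast
  define h where "h = (\<lambda>n. snd (f n))"
  define T where "T = (\<lambda>n. fst (f n))"
  have h0: "h 0 = x0" and T0: "T 0 = axis x0 1 - v" and T_le: "(norm (T n + u (h n)))\<^sup>2 \<le> C0 + C * real n"
    and kp: "0 < kern v (h n) (h (Suc n))" and T_Suc: "T (Suc n) = T n + axis (h (Suc n)) 1 - v" for n
    using f(1)[of 0] f(1)[of n] f(2)[of n] by (auto simp: P_def Q_def h_def T_def split: prod.splits)
  have T: "T n $ i = real (visits h n i) - (real n + 1) * v$i" for n i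
    by (induction n) (auto simp: T0 T_Suc visits_0 visits_Suc h0 axis_def algebra_simps)
  \<comment> \<open>Collects the corrector, the initial count 1 of the smoothing and its effect on
    the denominator.\<close>
  define B where "B = (\<Sum>x\<in>UNIV. norm (u x)) + 1 + real CARD('n)"
  define K where "K = sqrt (C0 + C) + B"
  have C0: "0 \<le> C0" by (simp add: C0_def)
  have B: "0 \<le> B" unfolding B_def by (intro add_nonneg_nonneg sum_nonneg) auto
  have bound: "norm (smooth_occ h n $ i - v$i) \<le> K * sqrt (inverse (real (Suc n)))" for n i
  proof -
    let ?q = "sqrt (real (Suc n))"
    have "norm (T n + u (h n)) \<le> sqrt (C0 + C * real n)"
      using T_le[of n] by (rule real_le_rsqrt)
    also have "\<dots> \<le> sqrt ((C0 + C) * real (Suc n))"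
      using C C0 by (intro real_sqrt_le_mono) (simp add: algebra_simps)
    finally have "norm (T n + u (h n)) \<le> sqrt (C0 + C) * ?q" by (simp add: real_sqrt_mult)
    moreover have "norm (u (h n)) \<le> (\<Sum>x\<in>UNIV. norm (u x))" by (rule member_le_sum) auto
    moreover have "norm (T n) \<le> norm (T n + u (h n)) + norm (u (h n))"
      using norm_triangle_ineq4[of "T n + u (h n)" "u (h n)"] by simp
    moreover have "\<bar>T n $ i\<bar> \<le> norm (T n)" by (rule component_le_norm_cart)
    moreover have "real CARD('n) * v$i \<le> real CARD('n)" using eq_le_1[OF eq, of i] by (simp add: mult_left_le)
    moreover have "0 \<le> real CARD('n) * v$i" using eq_orthant[OF eq] by simp
    ultimately have "\<bar>T n $ i + 1 - real CARD('n) * v$i\<bar> \<le> sqrt (C0 + C) * ?q + B"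
      unfolding B_def by linarith
    also have "\<dots> \<le> sqrt (C0 + C) * ?q + B * ?q" using B by (intro add_left_mono) (simp add: mult_le_cancel_left1)
    finally have num: "\<bar>T n $ i + 1 - real CARD('n) * v$i\<bar> \<le> K * ?q" by (simp add: K_def algebra_simps)
    have "smooth_occ h n $ i - v$i = (T n $ i + 1 - real CARD('n) * v$i) / (real n + 1 + real CARD('n))"
      unfolding T smooth_occ_def by (simp add: field_simps add_pos_nonneg)
    then have "norm (smooth_occ h n $ i - v$i) = \<bar>T n $ i + 1 - real CARD('n) * v$i\<bar> / (real n + 1 + real CARD('n))"
      by simp
    also have "\<dots> \<le> K * ?q / real (Suc n)"
      using num by (intro frac_le) auto
    also have "\<dots> = K * (?q / real (Suc n))" by simp
    also have "?q / real (Suc n) = sqrt (inverse (real (Suc n)))"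
      by (simp add: inverse_eq_divide sqrt_divide_self_eq real_sqrt_divide)
    finally show ?thesis .
  qed
  have lim: "(\<lambda>n. K * sqrt (inverse (real (Suc n)))) \<longlonglongrightarrow> 0"
    using tendsto_mult_left[OF tendsto_real_sqrt[OF LIMSEQ_inverse_real_of_nat], of K]
    by (simp only: real_sqrt_zero mult_zero_right)
  have "(\<lambda>n. smooth_occ h n) \<longlonglongrightarrow> v"
  proof (rule vec_tendstoI)
    fix i
    have "(\<lambda>n. smooth_occ h n $ i - v$i) \<longlonglongrightarrow> 0"
      using lim bound by (intro Lim_null_comparison[OF _ lim]) auto
    then show "(\<lambda>n. smooth_occ h n $ i) \<longlonglongrightarrow> v $ i" by (simp add: LIM_zero_iff)
  qed
  \<comment> \<open>A step possible for the chain frozen at \<open>v\<close> uses a nonzero entry of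
    \<open>A\<close>, so it is possible for the walk too, whose smoothed frequencies are all
    positive.\<close>
  moreover have "A $ h n $ h (Suc n) \<noteq> 0" for n
    using kp[of n] kern_zero_iff[OF reg, of "h n" "h (Suc n)"] by auto
  ultimately show ?thesis using that h0 by blast
qed

end

subsection \<open>Local supermartingales of finite-state processes\<close>

text \<open>Adaptedness expressed on path functionals, in place of a filtration of
  sigma-algebras.\<close>

definition depends_upto :: "nat \<Rightarrow> ((nat \<Rightarrow> 'n) \<Rightarrow> 'b) \<Rightarrow> bool" where
  "depends_upto n f \<longleftrightarrow> (\<forall>h h'. (\<forall>k\<le>n. h k = h' k) \<longrightarrow> f h = f h')"

lemma depends_uptoI: "(\<And>h h'. (\<And>k. k \<le> n \<Longrightarrow> h k = h' k) \<Longrightarrow> f h = f h') \<Longrightarrow> depends_upto n f"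
  unfolding depends_upto_def by blast

lemma depends_uptoD: "depends_upto n f \<Longrightarrow> (\<And>k. k \<le> n \<Longrightarrow> h k = h' k) \<Longrightarrow> f h = f h'"
  unfolding depends_upto_def by blast

lemma depends_upto_mono: "depends_upto m f \<Longrightarrow> m \<le> n \<Longrightarrow> depends_upto n f"
  unfolding depends_upto_def by (meson order_trans)

lemma depends_upto_const: "depends_upto n (\<lambda>h. c)"
  by (rule depends_uptoI) simp

lemma depends_upto_comp:
  fixes f :: "(nat \<Rightarrow> 'n) \<Rightarrow> 'b"
  assumes "depends_upto n f"
  shows "depends_upto n (\<lambda>h. F (f h))"
proof (rule depends_uptoI)
  fix h h' :: "nat \<Rightarrow> 'n" assume "\<And>k. k \<le> n \<Longrightarrow> h k = h' k"
  then have "f h = f h'" by (rule depends_uptoD[OF assms])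
  then show "F (f h) = F (f h')" by simp
qed

lemma depends_upto_comp2:
  fixes f :: "(nat \<Rightarrow> 'n) \<Rightarrow> 'b"
  assumes "depends_upto n f" "depends_upto n g"
  shows "depends_upto n (\<lambda>h. F (f h) (g h))"
proof (rule depends_uptoI)
  fix h h' :: "nat \<Rightarrow> 'n" assume eq: "\<And>k. k \<le> n \<Longrightarrow> h k = h' k"
  have "f h = f h'" "g h = g h'" using eq depends_uptoD[OF assms(1)] depends_uptoD[OF assms(2)] by blast+
  then show "F (f h) (g h) = F (f h') (g h')" by simp
qed

text \<open>The combinators are instantiated because a free \<open>F\<close> would leave
  higher-order unification ambiguous.\<close>

lemmas depends_intros = depends_upto_const
  depends_upto_comp[where F = of_bool] depends_upto_comp[where F = Not]
  depends_upto_comp2[where F = "(+)"] depends_upto_comp2[where F = "(-)"]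
  depends_upto_comp2[where F = "(*)"] depends_upto_comp2[where F = "(\<and>)"]

text \<open>\<open>T h n j\<close> plays the role of the conditional probability of \<open>j\<close>
  given the prefix of \<open>h\<close> up to time \<open>n\<close>, stated in product form so that
  null prefixes need no special case.\<close>

locale path_process = prob_space M
  for M :: "'w measure" and X :: "nat \<Rightarrow> 'w \<Rightarrow> 'n::finite" and T :: "(nat \<Rightarrow> 'n) \<Rightarrow> nat \<Rightarrow> 'n \<Rightarrow> real" +
  assumes X_measurable [measurable]: "\<And>n. X n \<in> measurable M (count_space UNIV)"
    and T_depends: "\<And>n j. depends_upto n (\<lambda>h. T h n j)"
    and T_prob: "\<And>n h j. prob {\<omega>\<in>space M. (\<forall>k\<le>n. X k \<omega> = h k) \<and> X (Suc n) \<omega> = j}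
      = T h n j * prob {\<omega>\<in>space M. \<forall>k\<le>n. X k \<omega> = h k}"
begin

definition path :: "'w \<Rightarrow> nat \<Rightarrow> 'n" where
  "path \<omega> = (\<lambda>n. X n \<omega>)"

text \<open>Extensional functions provide exactly one representative per prefix, hence a finite
  set.\<close>

definition prefixes :: "nat \<Rightarrow> (nat \<Rightarrow> 'n) set" where
  "prefixes n = PiE {..n} (\<lambda>_. UNIV)"

definition cylinder :: "nat \<Rightarrow> (nat \<Rightarrow> 'n) \<Rightarrow> 'w set" where
  "cylinder n h = {\<omega>\<in>space M. \<forall>k\<le>n. X k \<omega> = h k}"

definition E :: "((nat \<Rightarrow> 'n) \<Rightarrow> real) \<Rightarrow> real" where
  "E f = expectation (\<lambda>\<omega>. f (path \<omega>))"

lemma finite_prefixes: "finite (prefixes n)"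
  unfolding prefixes_def by (intro finite_PiE) auto

lemma cylinder_sets [measurable]: "cylinder n h \<in> events"
  unfolding cylinder_def by measurable

text \<open>The cylinders partition the space, so adapted functionals are simple functions;
  measurability and integrability come from this.\<close>

lemma sum_prefixes:
  fixes f :: "_ \<Rightarrow> real"
  assumes f: "depends_upto n f" and \<omega>: "\<omega> \<in> space M"
  shows "f (path \<omega>) = (\<Sum>h\<in>prefixes n. f h * indicator (cylinder n h) \<omega>)"
proof -
  let ?h = "restrict (path \<omega>) {..n}"
  have h: "?h \<in> prefixes n" by (auto simp: prefixes_def)
  have "indicator (cylinder n h) \<omega> = (if h = ?h then 1 else 0 :: real)" if "h \<in> prefixes n" for h
  proof -
    have "\<omega> \<in> cylinder n h \<longleftrightarrow> (\<forall>k\<le>n. h k = path \<omega> k)"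
      using \<omega> by (auto simp: cylinder_def path_def)
    also have "\<dots> \<longleftrightarrow> h = ?h"
      using that by (auto simp: prefixes_def PiE_iff extensional_def restrict_def fun_eq_iff)
    finally show ?thesis by (simp add: indicator_def)
  qed
  then have "(\<Sum>h\<in>prefixes n. f h * indicator (cylinder n h) \<omega>) = (\<Sum>h\<in>prefixes n. if h = ?h then f h else 0)"
    by (intro sum.cong) auto
  also have "\<dots> = f ?h" using h by (simp add: finite_prefixes)
  also have "\<dots> = f (path \<omega>)" by (rule depends_uptoD[OF f]) auto
  finally show ?thesis by simp
qed

lemma borel_measurable_path:
  fixes f :: "_ \<Rightarrow> real"
  assumes "depends_upto n f"
  shows "(\<lambda>\<omega>. f (path \<omega>)) \<in> borel_measurable M"
proof -
  have "(\<lambda>\<omega>. \<Sum>h\<in>prefixes n. f h * indicator (cylinder n h) \<omega>) \<in> borel_measurable M" by measurable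
  then show ?thesis using sum_prefixes[OF assms] by (subst measurable_cong) auto
qed

lemma integrable_path:
  fixes f :: "_ \<Rightarrow> real"
  assumes "depends_upto n f"
  shows "integrable M (\<lambda>\<omega>. f (path \<omega>))"
proof -
  have "integrable M (\<lambda>\<omega>. \<Sum>h\<in>prefixes n. f h * indicator (cylinder n h) \<omega>)"
    by (intro Bochner_Integration.integrable_sum integrable_mult_right integrable_real_indicator)
      (auto simp: emeasure_finite less_top[symmetric])
  then show ?thesis using sum_prefixes[OF assms] by (subst Bochner_Integration.integrable_cong) auto
qed

lemma E_prefixes:
  assumes "depends_upto n f"
  shows "E f = (\<Sum>h\<in>prefixes n. f h * prob (cylinder n h))"
proof -
  have "E f = expectation (\<lambda>\<omega>. \<Sum>h\<in>prefixes n. f h * indicator (cylinder n h) \<omega>)"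
    unfolding E_def using sum_prefixes[OF assms] by (intro Bochner_Integration.integral_cong) auto
  also have "\<dots> = (\<Sum>h\<in>prefixes n. f h * prob (cylinder n h))"
    by (subst Bochner_Integration.integral_sum)
      (auto intro!: integrable_mult_right integrable_real_indicator simp: emeasure_finite less_top[symmetric])
  finally show ?thesis .
qed

lemma E_mono:
  assumes "depends_upto n f" "depends_upto n g" "\<And>h. f h \<le> g h"
  shows "E f \<le> E g"
  unfolding E_prefixes[OF assms(1)] E_prefixes[OF assms(2)]
  using assms(3) by (intro sum_mono mult_right_mono) auto

lemma E_add:
  assumes "depends_upto n f" "depends_upto n g"
  shows "E (\<lambda>h. f h + g h) = E f + E g"
  unfolding E_def using assms by (intro Bochner_Integration.integral_add integrable_path)

lemma E_cmult: "E (\<lambda>h. c * f h) = c * E f"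
  unfolding E_def by simp

lemma E_nonneg: "(\<And>h. 0 \<le> f h) \<Longrightarrow> 0 \<le> E f"
  unfolding E_def by (intro Bochner_Integration.integral_nonneg)

lemma pred_path:
  assumes "depends_upto n P"
  shows "{\<omega>\<in>space M. P (path \<omega>)} \<in> events"
proof -
  have "depends_upto n (\<lambda>h. of_bool (P h) :: real)"
    by (intro depends_intros assms)
  from borel_measurable_path[OF this]
  have "{\<omega>\<in>space M. of_bool (P (path \<omega>)) = (1::real)} \<in> events" by measurable
  then show ?thesis by simp
qed

lemma E_of_bool:
  assumes "depends_upto n P"
  shows "E (\<lambda>h. of_bool (P h)) = prob {\<omega>\<in>space M. P (path \<omega>)}"
proof -
  have "E (\<lambda>h. of_bool (P h)) = expectation (indicator {\<omega>\<in>space M. P (path \<omega>)})"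
    unfolding E_def by (intro Bochner_Integration.integral_cong) (auto simp: indicator_def)
  also have "\<dots> = prob {\<omega>\<in>space M. P (path \<omega>)}"
    using pred_path[OF assms] by simp
  finally show ?thesis .
qed

text \<open>The tower property: split each cylinder by the next state and apply
  \<open>T_prob\<close>.\<close>

lemma E_tower:
  assumes f: "depends_upto (Suc n) f"
  shows "E f = E (\<lambda>h. \<Sum>j\<in>UNIV. T h n j * f (h(Suc n := j)))"
proof -
  let ?B = "\<lambda>h j. {\<omega>\<in>space M. (\<forall>k\<le>n. X k \<omega> = h k) \<and> X (Suc n) \<omega> = j}"
  let ?g = "\<lambda>h. \<Sum>j\<in>UNIV. T h n j * f (h(Suc n := j))"
  have B: "?B h j \<in> events" for h j by measurable
  have g: "depends_upto n ?g"
  proof (rule depends_uptoI)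
    fix h h' :: "nat \<Rightarrow> 'n" assume eq: "\<And>k. k \<le> n \<Longrightarrow> h k = h' k"
    have "T h n j = T h' n j" for j using depends_uptoD[OF T_depends] eq by blast
    moreover have "f (h(Suc n := j)) = f (h'(Suc n := j))" for j
      using eq by (intro depends_uptoD[OF f]) (auto simp: le_Suc_eq)
    ultimately show "?g h = ?g h'" by simp
  qed
  have "f (path \<omega>) = (\<Sum>h\<in>prefixes n. \<Sum>j\<in>UNIV. f (h(Suc n := j)) * indicator (?B h j) \<omega>)"
    if \<omega>: "\<omega> \<in> space M" for \<omega>
  proof -
    \<comment> \<open>Freezing the last coordinate at its value for the fixed \<omega> leaves a
      functional of the first \<open>n\<close> steps, to which \<open>sum_prefixes\<close>
      applies.\<close>
    let ?F = "\<lambda>h. f (h(Suc n := path \<omega> (Suc n)))"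
    have "depends_upto n ?F"
      by (intro depends_uptoI depends_uptoD[OF f]) (auto simp: le_Suc_eq)
    from sum_prefixes[OF this \<omega>]
    have "f (path \<omega>) = (\<Sum>h\<in>prefixes n. ?F h * indicator (cylinder n h) \<omega>)" by simp
    also have "\<dots> = (\<Sum>h\<in>prefixes n. \<Sum>j\<in>UNIV. f (h(Suc n := j)) * indicator (?B h j) \<omega>)"
    proof (intro sum.cong refl)
      fix h
      have "(\<Sum>j\<in>UNIV. f (h(Suc n := j)) * indicator (?B h j) \<omega>) =
        (\<Sum>j\<in>UNIV. if j = path \<omega> (Suc n) then ?F h * indicator (cylinder n h) \<omega> else 0)"
        by (intro sum.cong refl) (auto simp: indicator_def cylinder_def path_def)
      then show "?F h * indicator (cylinder n h) \<omega> = (\<Sum>j\<in>UNIV. f (h(Suc n := j)) * indicator (?B h j) \<omega>)"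
        by simp
    qed
    finally show ?thesis .
  qed
  then have "E f = expectation (\<lambda>\<omega>. \<Sum>h\<in>prefixes n. \<Sum>j\<in>UNIV. f (h(Suc n := j)) * indicator (?B h j) \<omega>)"
    unfolding E_def by (intro Bochner_Integration.integral_cong) auto
  also have "\<dots> = (\<Sum>h\<in>prefixes n. \<Sum>j\<in>UNIV. f (h(Suc n := j)) * prob (?B h j))"
  proof -
    have int: "integrable M (\<lambda>\<omega>. f (h(Suc n := j)) * indicator (?B h j) \<omega>)" for h j
      using B by (intro integrable_mult_right integrable_real_indicator)
        (auto simp: emeasure_finite less_top[symmetric])
    have "expectation (\<lambda>\<omega>. \<Sum>j\<in>UNIV. f (h(Suc n := j)) * indicator (?B h j) \<omega>) =
        (\<Sum>j\<in>UNIV. f (h(Suc n := j)) * prob (?B h j))" for h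
    proof (subst Bochner_Integration.integral_sum[OF int], intro sum.cong refl)
      fix j show "expectation (\<lambda>\<omega>. f (h(Suc n := j)) * indicator (?B h j) \<omega>) = f (h(Suc n := j)) * prob (?B h j)"
        using B[of h j] by (subst integral_mult_right_zero, subst Bochner_Integration.integral_indicator) simp_all
    qed
    then show ?thesis
      by (subst Bochner_Integration.integral_sum) (intro Bochner_Integration.integrable_sum int, simp)
  qed
  also have "\<dots> = (\<Sum>h\<in>prefixes n. ?g h * prob (cylinder n h))"
    unfolding T_prob cylinder_def by (simp add: sum_distrib_right mult_ac)
  also have "\<dots> = E ?g" using E_prefixes[OF g] by simp
  finally show ?thesis .
qed

end

text \<open>\<open>V\<close> is the Lyapunov function, \<open>Y\<close> its corrected version,
  \<open>e\<close> their vanishing gap. The drift is required only from time \<open>m\<close> on and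
  only where \<open>V\<close> is below \<epsilon>, hence the stopping below.\<close>

locale local_supermartingale = path_process +
  fixes Y V :: "nat \<Rightarrow> (nat \<Rightarrow> 'b) \<Rightarrow> real" and b e :: "nat \<Rightarrow> real" and m :: nat and \<epsilon> :: real
  assumes Y_depends: "\<And>n. depends_upto n (Y n)" and V_depends: "\<And>n. depends_upto n (V n)"
    and V_nonneg: "\<And>n h. 0 \<le> V n h" and V_le_Y: "\<And>n h. V n h \<le> Y n h"
    and Y_le_V: "\<And>n h. Y n h \<le> V n h + e n"
    and e_lim: "e \<longlonglongrightarrow> 0" and b_nonneg: "\<And>n. 0 \<le> b n" and b_div: "\<not> summable b"
    and \<epsilon>_pos: "0 < \<epsilon>"
    and drift: "\<And>n h. m \<le> n \<Longrightarrow> V n h < \<epsilon> \<Longrightarrow> (\<Sum>j\<in>UNIV. T h n j * Y (Suc n) (h(Suc n := j))) \<le> Y n h - b n * V n h"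
begin

lemma Y_nonneg: "0 \<le> Y n h"
  using V_nonneg V_le_Y order_trans by blast

definition confined :: "((nat \<Rightarrow> 'b) \<Rightarrow> bool) \<Rightarrow> nat \<Rightarrow> real \<Rightarrow> nat \<Rightarrow> (nat \<Rightarrow> 'b) \<Rightarrow> bool" where
  "confined I k \<delta> n h \<longleftrightarrow> I h \<and> (\<forall>i. k \<le> i \<and> i \<le> n \<longrightarrow> V i h < \<delta>)"

lemma depends_confined:
  assumes "depends_upto k I" "k \<le> n"
  shows "depends_upto n (confined I k \<delta> n)"
proof (rule depends_uptoI)
  fix h h' :: "nat \<Rightarrow> 'b" assume eq: "\<And>i. i \<le> n \<Longrightarrow> h i = h' i"
  have "I h = I h'" using assms eq by (intro depends_uptoD[OF assms(1)]) auto
  moreover have "V i h = V i h'" if "i \<le> n" for i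
    using that eq by (intro depends_uptoD[OF V_depends]) auto
  ultimately show "confined I k \<delta> n h = confined I k \<delta> n h'" by (auto simp: confined_def)
qed

lemma depends_mult_of_bool:
  assumes "depends_upto n f" "depends_upto n P"
  shows "depends_upto n (\<lambda>h. of_bool (P h) * (f h :: real))"
  by (intro depends_intros assms)

text \<open>\<open>g\<close> is \<open>Y\<close> stopped at the first exit and set to \<delta> from
  then on. At the exit \<open>Y\<close> is at least \<open>V\<close>, hence at least \<delta>, so
  this replacement only lowers it and the supermartingale inequality survives.\<close>

lemma confined_step:
  assumes I: "depends_upto k I" and k: "m \<le> k" "k \<le> n" and \<delta>: "0 < \<delta>" "\<delta> \<le> \<epsilon>"
  defines "g \<equiv> \<lambda>n h. of_bool (confined I k \<delta> n h) * Y n h + \<delta> * of_bool (I h \<and> \<not> confined I k \<delta> n h)"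
  shows "E (g (Suc n)) + b n * E (\<lambda>h. of_bool (confined I k \<delta> n h) * V n h) \<le> E (g n)"
proof -
  let ?J = "confined I k \<delta>"
  let ?R = "\<lambda>h. of_bool (I h \<and> \<not> ?J n h) :: real"
  let ?f = "\<lambda>h. of_bool (?J n h) * Y (Suc n) h"
  have J: "depends_upto n (?J n)" by (rule depends_confined[OF I k(2)])
  have JS: "depends_upto (Suc n) (?J (Suc n))" using k by (intro depends_confined[OF I]) simp
  have I': "depends_upto n I" by (rule depends_upto_mono[OF I k(2)])
  have R: "depends_upto n ?R" by (intro depends_intros J I')
  have f: "depends_upto (Suc n) ?f"
    by (rule depends_mult_of_bool[OF Y_depends depends_upto_mono[OF J]]) simp
  have gS: "depends_upto (Suc n) (g (Suc n))"
    unfolding g_def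
    by (intro depends_intros JS depends_upto_mono[OF I' le_SucI[OF order_refl]] Y_depends)
  have gn: "depends_upto n (g n)"
    unfolding g_def by (intro depends_intros J I' Y_depends)
  have fR: "depends_upto (Suc n) (\<lambda>h. ?f h + \<delta> * ?R h)"
    by (intro depends_upto_comp2[where F = "(+)"] depends_upto_comp2[where F = "(*)"] depends_upto_const
        f depends_upto_mono[OF R le_SucI[OF order_refl]])
  have "g (Suc n) h \<le> ?f h + \<delta> * ?R h" for h
  proof (cases "?J n h")
    case True
    then have I: "I h" by (simp add: confined_def)
    show ?thesis
    proof (cases "?J (Suc n) h")
      case False
      then have "\<delta> \<le> V (Suc n) h" using True k by (auto simp: confined_def le_Suc_eq not_less)
      then show ?thesis using True False I V_le_Y[of "Suc n" h] by (simp add: g_def)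
    qed (use True in \<open>simp add: g_def\<close>)
  next
    case False
    then have "\<not> ?J (Suc n) h" by (auto simp: confined_def)
    then show ?thesis using False by (simp add: g_def)
  qed
  then have "E (g (Suc n)) \<le> E (\<lambda>h. ?f h + \<delta> * ?R h)" by (rule E_mono[OF gS fR])
  also have "\<dots> = E ?f + \<delta> * E ?R"
    unfolding E_cmult[symmetric]
    by (intro E_add[OF f] depends_upto_comp2[where F = "(*)"] depends_upto_const
        depends_upto_mono[OF R le_SucI[OF order_refl]])
  also have "E ?f = E (\<lambda>h. \<Sum>j\<in>UNIV. T h n j * ?f (h(Suc n := j)))" by (rule E_tower[OF f])
  also have "(\<lambda>h. \<Sum>j\<in>UNIV. T h n j * ?f (h(Suc n := j))) =
     (\<lambda>h. of_bool (?J n h) * (\<Sum>j\<in>UNIV. T h n j * Y (Suc n) (h(Suc n := j))))"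
  proof
    fix h
    have "?J n (h(Suc n := j)) = ?J n h" for j by (rule depends_uptoD[OF J]) auto
    then show "(\<Sum>j\<in>UNIV. T h n j * ?f (h(Suc n := j))) =
       of_bool (?J n h) * (\<Sum>j\<in>UNIV. T h n j * Y (Suc n) (h(Suc n := j)))"
      by (simp add: sum_distrib_left mult_ac)
  qed
  also have "E \<dots> \<le> E (\<lambda>h. of_bool (?J n h) * (Y n h - b n * V n h))"
  proof (rule E_mono[of n])
    have "depends_upto n (\<lambda>h. \<Sum>j\<in>UNIV. T h n j * Y (Suc n) (h(Suc n := j)))"
    proof (rule depends_uptoI, intro sum.cong refl arg_cong2[where f = "(*)"])
      fix h h' :: "nat \<Rightarrow> 'b" and j assume eq: "\<And>k. k \<le> n \<Longrightarrow> h k = h' k"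
      show "T h n j = T h' n j" using eq by (rule depends_uptoD[OF T_depends])
      show "Y (Suc n) (h(Suc n := j)) = Y (Suc n) (h'(Suc n := j))"
        using eq by (intro depends_uptoD[OF Y_depends]) (auto simp: le_Suc_eq)
    qed
    then show "depends_upto n (\<lambda>h. of_bool (?J n h) * (\<Sum>j\<in>UNIV. T h n j * Y (Suc n) (h(Suc n := j))))"
      using J by (rule depends_mult_of_bool)
    have "depends_upto n (\<lambda>h. Y n h - b n * V n h)"
      by (intro depends_intros Y_depends V_depends)
    then show "depends_upto n (\<lambda>h. of_bool (?J n h) * (Y n h - b n * V n h))"
      using J by (rule depends_mult_of_bool)
    show "of_bool (?J n h) * (\<Sum>j\<in>UNIV. T h n j * Y (Suc n) (h(Suc n := j)))
      \<le> of_bool (?J n h) * (Y n h - b n * V n h)" for h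
    proof (cases "?J n h")
      case True
      then have "V n h < \<epsilon>" using k \<delta> by (force simp: confined_def)
      then show ?thesis using drift[of n h] k True by simp
    qed simp
  qed
  also have "\<dots> = E (\<lambda>h. of_bool (?J n h) * Y n h + (- b n) * (of_bool (?J n h) * V n h))"
    by (simp add: algebra_simps)
  also have "\<dots> = E (\<lambda>h. of_bool (?J n h) * Y n h) + (- b n) * E (\<lambda>h. of_bool (?J n h) * V n h)"
    unfolding E_cmult[symmetric] by (intro E_add[of n] depends_intros J Y_depends V_depends)
  finally have "E (g (Suc n)) \<le> E (\<lambda>h. of_bool (?J n h) * Y n h) - b n * E (\<lambda>h. of_bool (?J n h) * V n h) + \<delta> * E ?R"
    by simp
  moreover have "E (g n) = E (\<lambda>h. of_bool (?J n h) * Y n h) + \<delta> * E ?R"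
    unfolding g_def E_cmult[symmetric] by (intro E_add[of n] depends_intros J I' Y_depends)
  ultimately show ?thesis by simp
qed

text \<open>Telescoping \<open>confined_step\<close>. The exit term yields the maximal inequality,
  the accumulated drift yields smallness at a late time.\<close>

lemma confined_bound:
  assumes I: "depends_upto k I" and k: "m \<le> k" "k \<le> n" and \<delta>: "0 < \<delta>" "\<delta> \<le> \<epsilon>"
  shows "\<delta> * prob {\<omega>\<in>space M. I (path \<omega>) \<and> \<not> confined I k \<delta> n (path \<omega>)}
      + (\<Sum>i=k..<n. b i * E (\<lambda>h. of_bool (confined I k \<delta> i h) * V i h)) \<le> E (\<lambda>h. of_bool (I h) * Y k h)"
proof -
  let ?J = "confined I k \<delta>"
  define g where "g = (\<lambda>n h. of_bool (?J n h) * Y n h + \<delta> * of_bool (I h \<and> \<not> ?J n h))"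
  have "E (g n) + (\<Sum>i=k..<n. b i * E (\<lambda>h. of_bool (?J i h) * V i h)) \<le> E (\<lambda>h. of_bool (I h) * Y k h)"
    using k(2)
  proof (induction n rule: dec_induct)
    case base
    have "E (g k) \<le> E (\<lambda>h. of_bool (I h) * Y k h)"
    proof (rule E_mono[of k])
      have J: "depends_upto k (?J k)" by (rule depends_confined[OF I order_refl])
      show "depends_upto k (g k)"
        unfolding g_def by (intro depends_intros J I Y_depends)
      show "depends_upto k (\<lambda>h. of_bool (I h) * Y k h)" by (rule depends_mult_of_bool[OF Y_depends I])
      show "g k h \<le> of_bool (I h) * Y k h" for h
        using V_le_Y[of k h] by (auto simp: g_def confined_def not_less)
    qed
    then show ?case by simp
  next
    case (step n)
    have "E (g (Suc n)) + b n * E (\<lambda>h. of_bool (?J n h) * V n h) \<le> E (g n)"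
      unfolding g_def using confined_step[OF I k(1) step(1) \<delta>] .
    then show ?case using step by simp
  qed
  moreover have "\<delta> * prob {\<omega>\<in>space M. I (path \<omega>) \<and> \<not> ?J n (path \<omega>)} \<le> E (g n)"
  proof -
    have J: "depends_upto n (?J n)" by (rule depends_confined[OF I k(2)])
    have IJ: "depends_upto n (\<lambda>h. I h \<and> \<not> ?J n h)"
      by (intro depends_intros J depends_upto_mono[OF I k(2)])
    have "E (\<lambda>h. \<delta> * of_bool (I h \<and> \<not> ?J n h)) \<le> E (g n)"
    proof (rule E_mono[of n])
      show "depends_upto n (\<lambda>h. \<delta> * of_bool (I h \<and> \<not> ?J n h))"
        by (intro depends_upto_comp2[where F = "(*)"] depends_upto_comp[where F = of_bool] depends_upto_const IJ)
      show "depends_upto n (g n)"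
        unfolding g_def by (intro depends_intros J depends_upto_mono[OF I k(2)] Y_depends)
      show "\<delta> * of_bool (I h \<and> \<not> ?J n h) \<le> g n h" for h
        using Y_nonneg by (simp add: g_def)
    qed
    then show ?thesis by (simp only: E_cmult E_of_bool[OF IJ])
  qed
  ultimately show ?thesis by simp
qed

text \<open>The drift sum is dropped and the increasing exit events are followed to their limit.
  Keeping the initial event \<open>I\<close> and time \<open>k\<close> arbitrary is what permits a
  restart.\<close>

lemma maximal_inequality:
  assumes I: "depends_upto k I" and k: "m \<le> k" and \<delta>: "0 < \<delta>" "\<delta> \<le> \<epsilon>"
  shows "\<delta> * prob {\<omega>\<in>space M. I (path \<omega>) \<and> (\<exists>i\<ge>k. \<delta> \<le> V i (path \<omega>))} \<le> E (\<lambda>h. of_bool (I h) * Y k h)"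
proof -
  let ?J = "confined I k \<delta>"
  let ?A = "\<lambda>n. {\<omega>\<in>space M. I (path \<omega>) \<and> \<not> ?J n (path \<omega>)}"
  have ev: "?A n \<in> events" if "k \<le> n" for n
    by (intro pred_path[of n] depends_intros depends_confined[OF I that] depends_upto_mono[OF I that])
  have A: "{\<omega>\<in>space M. I (path \<omega>) \<and> (\<exists>i\<ge>k. \<delta> \<le> V i (path \<omega>))} = (\<Union>n. ?A (n + k))"
  proof (intro equalityI subsetI)
    fix \<omega> assume "\<omega> \<in> {\<omega>\<in>space M. I (path \<omega>) \<and> (\<exists>i\<ge>k. \<delta> \<le> V i (path \<omega>))}"
    then obtain i where i: "\<omega> \<in> space M" "I (path \<omega>)" "k \<le> i" "\<delta> \<le> V i (path \<omega>)" by blast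
    then have "\<omega> \<in> ?A (i - k + k)" by (auto simp: confined_def not_less)
    then show "\<omega> \<in> (\<Union>n. ?A (n + k))" by blast
  qed (auto simp: confined_def not_less)
  have "incseq (\<lambda>n. ?A (n + k))" by (rule incseq_SucI) (auto simp: confined_def)
  then have "(\<lambda>n. prob (?A (n + k))) \<longlonglongrightarrow> prob (\<Union>n. ?A (n + k))"
    using ev by (intro finite_Lim_measure_incseq) auto
  then have "(\<lambda>n. \<delta> * prob (?A (n + k))) \<longlonglongrightarrow> \<delta> * prob (\<Union>n. ?A (n + k))" by (rule tendsto_mult_left)
  moreover have "\<delta> * prob (?A (n + k)) \<le> E (\<lambda>h. of_bool (I h) * Y k h)" for n
  proof -
    have "0 \<le> (\<Sum>i=k..<n+k. b i * E (\<lambda>h. of_bool (?J i h) * V i h))"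
      by (intro sum_nonneg mult_nonneg_nonneg b_nonneg E_nonneg V_nonneg) auto
    then show ?thesis using confined_bound[OF I k _ \<delta>, of "n + k"] by simp
  qed
  ultimately show ?thesis unfolding A by (intro LIMSEQ_le_const2) auto
qed

text \<open>Otherwise, the gap \<open>e\<close> being negligible, the confined mean of
  \<open>V\<close> would stay above \<open>\<eta> / 2\<close> at late times, and the accumulated
  drift, which is bounded, would make \<open>b\<close> summable.\<close>

lemma exists_small_confined:
  assumes I: "depends_upto m I" and \<eta>: "0 < \<eta>"
  shows "\<exists>k\<ge>m. E (\<lambda>h. of_bool (confined I m \<epsilon> k h) * Y k h) < \<eta>"
proof (rule ccontr)
  let ?J = "confined I m \<epsilon>"
  assume "\<not> ?thesis"
  then have ge: "\<eta> \<le> E (\<lambda>h. of_bool (?J k h) * Y k h)" if "m \<le> k" for k using that by (auto simp: not_less)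
  have "\<forall>\<^sub>F n in sequentially. e n < \<eta> / 2"
    using e_lim \<eta> by (intro order_tendstoD) auto
  then obtain k0 where k0: "\<And>n. k0 \<le> n \<Longrightarrow> e n < \<eta> / 2" by (auto simp: eventually_sequentially)
  define k1 where "k1 = max m k0"
  have V: "\<eta> / 2 \<le> E (\<lambda>h. of_bool (?J k h) * V k h)" if "k1 \<le> k" for k
  proof -
    have mk: "m \<le> k" "k0 \<le> k" using that by (auto simp: k1_def)
    have J: "depends_upto k (?J k)" by (rule depends_confined[OF I mk(1)])
    note dV = depends_mult_of_bool[OF V_depends J]
    have c: "depends_upto k (\<lambda>h. \<eta> / 2 :: real)" by (rule depends_uptoI) simp
    have "E (\<lambda>h. of_bool (?J k h) * Y k h) \<le> E (\<lambda>h. of_bool (?J k h) * V k h + \<eta> / 2)"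
    proof (rule E_mono[OF depends_mult_of_bool[OF Y_depends J]])
      show "depends_upto k (\<lambda>h. of_bool (?J k h) * V k h + \<eta> / 2)"
        by (intro depends_intros J V_depends)
      show "of_bool (?J k h) * Y k h \<le> of_bool (?J k h) * V k h + \<eta> / 2" for h
        using Y_le_V[of k h] k0[OF mk(2)] \<eta> by auto
    qed
    also have "\<dots> = E (\<lambda>h. of_bool (?J k h) * V k h) + \<eta> / 2"
      by (subst E_add[OF dV c]) (simp add: E_def prob_space)
    finally show ?thesis using ge[OF mk(1)] by simp
  qed
  have "summable (\<lambda>i. b (i + k1))"
  proof (rule summableI_nonneg_bounded)
    show "0 \<le> b (n + k1)" for n by (rule b_nonneg)
    show "(\<Sum>i<n. b (i + k1)) \<le> E (\<lambda>h. of_bool (I h) * Y m h) / (\<eta> / 2)" for n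
    proof -
      have "(\<Sum>i<n. b (i + k1)) = (\<Sum>i=k1..<n+k1. b i)"
        using sum.shift_bounds_nat_ivl[of b 0 k1 n] by (simp add: atLeast0LessThan)
      then have "(\<Sum>i<n. b (i + k1)) * (\<eta> / 2) = (\<Sum>i=k1..<n+k1. b i * (\<eta> / 2))"
        by (simp only: sum_distrib_right)
      also have "\<dots> \<le> (\<Sum>i=k1..<n+k1. b i * E (\<lambda>h. of_bool (?J i h) * V i h))"
        by (intro sum_mono mult_left_mono V b_nonneg) auto
      also have "\<dots> \<le> (\<Sum>i=m..<n+k1. b i * E (\<lambda>h. of_bool (?J i h) * V i h))"
        by (intro sum_mono2 mult_nonneg_nonneg b_nonneg E_nonneg V_nonneg) (auto simp: k1_def)
      also have "\<dots> \<le> E (\<lambda>h. of_bool (I h) * Y m h)"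
      proof -
        have "0 \<le> \<epsilon> * prob {\<omega>\<in>space M. I (path \<omega>) \<and> \<not> ?J (n + k1) (path \<omega>)}"
          using \<epsilon>_pos by simp
        moreover have "m \<le> n + k1" by (simp add: k1_def)
        ultimately show ?thesis
          using confined_bound[OF I order_refl _ \<epsilon>_pos order_refl, of "n + k1"] by linarith
      qed
      finally show ?thesis using \<eta> by (simp add: field_simps)
    qed
  qed
  then have "summable b" by (subst (asm) summable_iff_shift)
  then show False using b_div by simp
qed

theorem convergence_positive:
  assumes pos: "0 < prob (cylinder m h0)" and start: "Y m h0 < \<epsilon>"
  shows "0 < prob {\<omega>\<in>space M. (\<lambda>n. V n (path \<omega>)) \<longlonglongrightarrow> 0}"
proof -
  define I where "I = (\<lambda>h. \<forall>k\<le>m. h k = h0 k)"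
  have I: "depends_upto m I" by (rule depends_uptoI) (auto simp: I_def)
  have cyl: "{\<omega>\<in>space M. I (path \<omega>)} = cylinder m h0"
    by (auto simp: I_def cylinder_def path_def)
  have [measurable]: "(\<lambda>\<omega>. V n (path \<omega>)) \<in> borel_measurable M" for n
    by (rule borel_measurable_path[OF V_depends])
  have Iev: "{\<omega>\<in>space M. I (path \<omega>)} \<in> events" by (rule pred_path[OF I])
  then have [measurable]: "Measurable.pred M (\<lambda>\<omega>. I (path \<omega>))" by (simp add: pred_def)
  define G where "G = {\<omega>\<in>space M. I (path \<omega>) \<and> (\<forall>i\<ge>m. V i (path \<omega>) < \<epsilon>)}"
  define U where "U = {\<omega>\<in>space M. I (path \<omega>) \<and> (\<exists>i\<ge>m. \<epsilon> \<le> V i (path \<omega>))}"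
  have [measurable]: "G \<in> events" "U \<in> events" unfolding G_def U_def by measurable
  have "\<epsilon> * prob U \<le> E (\<lambda>h. of_bool (I h) * Y m h)"
    unfolding U_def by (rule maximal_inequality[OF I order_refl \<epsilon>_pos order_refl])
  also have "(\<lambda>h. of_bool (I h) * Y m h) = (\<lambda>h. Y m h0 * of_bool (I h))"
  proof
    fix h show "of_bool (I h) * Y m h = Y m h0 * of_bool (I h)"
      using depends_uptoD[OF Y_depends, of m h h0] by (auto simp: I_def)
  qed
  also have "E \<dots> = Y m h0 * prob (cylinder m h0)"
    by (simp only: E_cmult E_of_bool[OF I] cyl)
  also have "\<dots> < \<epsilon> * prob (cylinder m h0)" using pos start by (intro mult_strict_right_mono)
  finally have "prob U < prob (cylinder m h0)" using \<epsilon>_pos by simp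
  moreover have "cylinder m h0 = G \<union> U" unfolding cyl[symmetric] G_def U_def by (auto simp: not_le)
  then have "prob (cylinder m h0) \<le> prob G + prob U"
    using measure_Un_le[of G M U] by simp
  ultimately have G: "0 < prob G" by linarith
  \<comment> \<open>Never leaving the \<epsilon>-region yet returning above a fixed level infinitely
    often. The minimum with \<epsilon> keeps the level in the range of
    \<open>maximal_inequality\<close>.\<close>
  define B where "B = (\<lambda>q::nat. {\<omega>\<in>G. \<forall>k. \<exists>i\<ge>k. min \<epsilon> (1 / real (Suc q)) \<le> V i (path \<omega>)})"
  have Bev [measurable]: "B q \<in> events" for q
  proof -
    have "B q = G \<inter> {\<omega>\<in>space M. \<forall>k. \<exists>i\<ge>k. min \<epsilon> (1 / real (Suc q)) \<le> V i (path \<omega>)}"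
      by (auto simp: B_def G_def)
    also have "\<dots> \<in> events" by measurable
    finally show ?thesis .
  qed
  have B0: "prob (B q) = 0" for q
  proof -
    define \<delta> where "\<delta> = min \<epsilon> (1 / real (Suc q))"
    have \<delta>: "0 < \<delta>" "\<delta> \<le> \<epsilon>" using \<epsilon>_pos by (auto simp: \<delta>_def)
    \<comment> \<open>On \<open>B q\<close> the path is confined up to every time \<open>k\<close>
      and exceeds \<delta> after it; \<open>k\<close> is chosen so late that the restarted maximal
      inequality gives less than \<eta>.\<close>
    have "prob (B q) < \<eta>" if \<eta>: "0 < \<eta>" for \<eta>
    proof -
      obtain k where k: "m \<le> k" and small: "E (\<lambda>h. of_bool (confined I m \<epsilon> k h) * Y k h) < \<delta> * \<eta>"
        using exists_small_confined[OF I, of "\<delta> * \<eta>"] \<delta> \<eta> by auto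
      let ?J = "confined I m \<epsilon> k"
      have J: "depends_upto k ?J" by (rule depends_confined[OF I k])
      then have [measurable]: "Measurable.pred M (\<lambda>\<omega>. ?J (path \<omega>))" using pred_path by (simp add: pred_def)
      have "\<delta> * prob (B q) \<le> \<delta> * prob {\<omega>\<in>space M. ?J (path \<omega>) \<and> (\<exists>i\<ge>k. \<delta> \<le> V i (path \<omega>))}"
        using \<delta> by (intro mult_left_mono finite_measure_mono) (auto simp: B_def G_def confined_def \<delta>_def)
      also have "\<dots> \<le> E (\<lambda>h. of_bool (?J h) * Y k h)"
        by (rule maximal_inequality[OF J k \<delta>])
      also note small
      finally show ?thesis using \<delta> by simp
    qed
    from this[of "prob (B q)"] show ?thesis using measure_nonneg[of M "B q"] by linarith
  qed
  have "(\<Union>q. B q) \<in> null_sets M"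
    using B0 by (intro null_sets_UN) (auto simp: null_sets_def emeasure_eq_measure)
  then have "prob (G - (\<Union>q. B q)) = prob G"
    by (intro measure_Diff_null_set) simp_all
  moreover have "prob (G - (\<Union>q. B q)) \<le> prob {\<omega>\<in>space M. (\<lambda>n. V n (path \<omega>)) \<longlonglongrightarrow> 0}"
  proof (rule finite_measure_mono)
    show "G - (\<Union>q. B q) \<subseteq> {\<omega>\<in>space M. (\<lambda>n. V n (path \<omega>)) \<longlonglongrightarrow> 0}"
    proof
      fix \<omega> assume \<omega>: "\<omega> \<in> G - (\<Union>q. B q)"
      have "\<exists>k. \<forall>i\<ge>k. norm (V i (path \<omega>) - 0) < r" if r: "0 < r" for r
      proof -
        obtain q where q: "inverse (real (Suc q)) < r" using reals_Archimedean[OF r] by blast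
        have "\<omega> \<notin> B q" using \<omega> by blast
        then have "\<not> (\<forall>k. \<exists>i\<ge>k. min \<epsilon> (1 / real (Suc q)) \<le> V i (path \<omega>))"
          using \<omega> unfolding B_def by blast
        then obtain k where k: "\<forall>i\<ge>k. V i (path \<omega>) < min \<epsilon> (1 / real (Suc q))"
          by (meson not_le)
        then have "V i (path \<omega>) < r" if "k \<le> i" for i
          using q k that by (fastforce simp: inverse_eq_divide)
        then show ?thesis using V_nonneg by auto
      qed
      then have "(\<lambda>n. V n (path \<omega>)) \<longlonglongrightarrow> 0" by (intro LIMSEQ_I)
      then show "\<omega> \<in> {\<omega>\<in>space M. (\<lambda>n. V n (path \<omega>)) \<longlonglongrightarrow> 0}" using \<omega> by (simp add: G_def)
    qed
    show "{\<omega>\<in>space M. (\<lambda>n. V n (path \<omega>)) \<longlonglongrightarrow> 0} \<in> events" by measurable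
  qed
  ultimately show ?thesis using G by linarith
qed

end

subsection \<open>Convergence with positive probability\<close>

lemma step_size_pos: "0 < step_size t n"
  unfolding step_size_def by (simp add: add_pos_nonneg)

lemma step_size_diff: "step_size t n - step_size t (Suc n) = step_size t n * step_size t (Suc n)"
  for t :: "'n::finite itself"
proof -
  define c where "c = real n + 2 + real CARD('n)"
  have c: "0 < c" unfolding c_def by (simp add: add_pos_nonneg)
  have eqs: "step_size t n = 1 / c" "step_size t (Suc n) = 1 / (c + 1)"
    by (simp_all add: step_size_def c_def add_ac)
  show ?thesis unfolding eqs using c by (simp add: field_simps)
qed

lemma step_size_Suc_ge: "step_size t n / 2 \<le> step_size t (Suc n)"
  for t :: "'n::finite itself"
proof -
  define c where "c = real n + 2 + real CARD('n)"
  have c: "1 \<le> c" unfolding c_def by simp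
  have eqs: "step_size t n = 1 / c" "step_size t (Suc n) = 1 / (c + 1)"
    by (simp_all add: step_size_def c_def add_ac)
  show ?thesis unfolding eqs using c by (simp add: field_simps)
qed

lemma step_size_harmonic: "step_size (t :: 'n::finite itself) n = inverse (real (Suc (n + (CARD('n) + 1))))"
  by (simp add: step_size_def inverse_eq_divide add_ac)

lemma step_size_tendsto: "step_size (t :: 'n::finite itself) \<longlonglongrightarrow> 0"
  unfolding step_size_harmonic using LIMSEQ_ignore_initial_segment[OF LIMSEQ_inverse_real_of_nat] .

lemma not_summable_step_size: "\<not> summable (step_size (t :: 'n::finite itself))"
proof
  assume "summable (step_size t)"
  then have "summable (\<lambda>n. inverse (real (Suc (n + (CARD('n) + 1)))))"
    unfolding step_size_harmonic .
  then have "summable (\<lambda>n. inverse (real (Suc n)))" by (subst (asm) summable_iff_shift)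
  then have "summable (\<lambda>n. inverse (real n))" by (subst (asm) summable_Suc_iff)
  then show False using not_summable_harmonic[where 'a = real] by simp
qed

text \<open>With \<open>N\<close> states, raw and smoothed frequencies differ by
  \<open>(N * w - 1) / (n + 1)\<close>, where \<open>w\<close> is the smoothed one.\<close>

lemma smooth_occ_tendsto_imp_occ:
  fixes v :: "real^'n"
  assumes "(\<lambda>n. smooth_occ (\<lambda>k. X k \<omega>) n) \<longlonglongrightarrow> v"
  shows "(\<lambda>n. occ X n \<omega>) \<longlonglongrightarrow> v"
proof (rule vec_tendstoI)
  fix i
  let ?w = "\<lambda>n. smooth_occ (\<lambda>k. X k \<omega>) n $ i" and ?N = "real CARD('n)"
  have w: "?w \<longlonglongrightarrow> v$i" using assms by (rule tendsto_vec_nth)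
  have "(\<lambda>n. ?w n + (?N * ?w n - 1) * inverse (real (Suc n))) \<longlonglongrightarrow> v$i + (?N * v$i - 1) * 0"
    by (intro tendsto_intros w LIMSEQ_inverse_real_of_nat)
  moreover have "?w n + (?N * ?w n - 1) * inverse (real (Suc n)) = occ X n \<omega> $ i" for n
  proof -
    define q where "q = real (Suc n)"
    define z where "z = real (visits (\<lambda>k. X k \<omega>) n i)"
    have q: "0 < q" by (simp add: q_def)
    have "?w n = (1 + z) / (q + ?N)" by (simp add: smooth_occ_def z_def q_def add_ac)
    moreover have "occ X n \<omega> $ i = z / q" by (simp add: occ_def z_def q_def)
    moreover have "(1 + z) / (q + ?N) + (?N * ((1 + z) / (q + ?N)) - 1) * inverse q = z / q"
    proof -
      define w where "w = (1 + z) / (q + ?N)"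
      have "z = w * (q + ?N) - 1" using q by (simp add: w_def add_pos_nonneg)
      then show ?thesis using q unfolding w_def[symmetric] by (simp add: field_simps)
    qed
    ultimately show ?thesis unfolding q_def by simp
  qed
  ultimately show "(\<lambda>n. occ X n \<omega> $ i) \<longlonglongrightarrow> v $ i" by simp
qed

context reinforcement
begin

lemma vrrw_trans_depends: "depends_upto n (\<lambda>h. vrrw_trans A \<alpha> h n j)"
proof (rule depends_uptoI)
  fix h h' :: "nat \<Rightarrow> 'n" assume eq: "\<And>k. k \<le> n \<Longrightarrow> h k = h' k"
  then have "smooth_occ h n = smooth_occ h' n" by (rule smooth_occ_cong)
  then show "vrrw_trans A \<alpha> h n j = vrrw_trans A \<alpha> h' n j" using eq by (simp add: vrrw_trans_kern)
qed

lemma is_vrrw_path_process: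
  assumes "is_vrrw M A \<alpha> x0 X"
  shows "path_process M X (vrrw_trans A \<alpha>)"
  using assms unfolding is_vrrw_def path_process_def path_process_axioms_def
  by (auto intro: vrrw_trans_depends)

lemma cylinder_pos:
  assumes vrrw: "is_vrrw M A \<alpha> x0 X" and h: "h 0 = x0" "\<And>n. A $ h n $ h (Suc n) \<noteq> 0"
  shows "0 < measure M {\<omega>\<in>space M. \<forall>k\<le>n. X k \<omega> = h k}"
proof (induction n)
  case 0
  have "{\<omega>\<in>space M. \<forall>k\<le>0. X k \<omega> = h k} = space M"
    using vrrw h(1) unfolding is_vrrw_def by auto
  moreover have "prob_space M" using vrrw unfolding is_vrrw_def by simp
  ultimately show ?case by (simp add: prob_space.prob_space)
next
  case (Suc n)
  have reg: "regular (smooth_occ h n)" by (intro regular_pos smooth_occ_pos)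
  have "kern (smooth_occ h n) (h n) (h (Suc n)) \<noteq> 0"
    using h(2)[of n] smooth_occ_pos[of h n "h (Suc n)"] by (simp add: kern_zero_iff[OF reg])
  then have k: "0 < vrrw_trans A \<alpha> h n (h (Suc n))"
    using kern_nonneg[OF reg] unfolding vrrw_trans_kern by (simp add: less_le)
  have "{\<omega>\<in>space M. \<forall>k\<le>Suc n. X k \<omega> = h k} = {\<omega>\<in>space M. (\<forall>k\<le>n. X k \<omega> = h k) \<and> X (Suc n) \<omega> = h (Suc n)}"
    by (auto simp: le_Suc_eq)
  then have "measure M {\<omega>\<in>space M. \<forall>k\<le>Suc n. X k \<omega> = h k} =
    vrrw_trans A \<alpha> h n (h (Suc n)) * measure M {\<omega>\<in>space M. \<forall>k\<le>n. X k \<omega> = h k}"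
    using vrrw unfolding is_vrrw_def by simp
  then show ?case using k Suc by simp
qed

lemma lyap_tendsto:
  assumes "(\<lambda>n. w n) \<longlonglongrightarrow> v"
  shows "(\<lambda>n. lyap v (w n)) \<longlonglongrightarrow> 0"
proof -
  have "(\<lambda>n. \<Sum>i\<in>UNIV. eq_weight v i * (w n - v) $ i * (w n - v) $ i) \<longlonglongrightarrow>
    (\<Sum>i\<in>UNIV. eq_weight v i * (v - v) $ i * (v - v) $ i)"
    by (intro tendsto_intros assms)
  then show ?thesis by (simp add: lyap_def wdot_def)
qed

lemma norm_le_lyap:
  assumes "equilibrium A \<alpha> v"
  shows "(norm (w - v))\<^sup>2 \<le> lyap v w"
  unfolding lyap_def by (rule norm_le_wdot[OF eq_weight_ge_1[OF assms]])

lemma lyap_tendsto_imp: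
  assumes eq: "equilibrium A \<alpha> v" and lim: "(\<lambda>n. lyap v (w n)) \<longlonglongrightarrow> 0"
  shows "w \<longlonglongrightarrow> v"
proof -
  have "(\<lambda>n. (norm (w n - v))\<^sup>2) \<longlonglongrightarrow> 0"
    by (rule Lim_null_comparison[OF _ lim]) (simp add: norm_le_lyap[OF eq])
  then have "(\<lambda>n. sqrt ((norm (w n - v))\<^sup>2)) \<longlonglongrightarrow> sqrt 0" by (rule tendsto_real_sqrt)
  then show ?thesis by (simp add: tendsto_norm_zero_iff LIM_zero_iff)
qed

theorem vrrw_converges_with_positive_probability:
  assumes vrrw: "is_vrrw M A \<alpha> x0 X" and stable: "linearly_stable A \<alpha> v"
  shows "0 < measure M {\<omega>\<in>space M. (\<lambda>n. occ X n \<omega>) \<longlonglongrightarrow> v}"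
proof -
  interpret path_process M X "vrrw_trans A \<alpha>" by (rule is_vrrw_path_process[OF vrrw])
  have eq: "equilibrium A \<alpha> v" by (rule linearly_stable_equilibrium[OF stable])
  obtain R c r C s0 where pos: "0 < c" "0 < r" "0 < C" "0 < s0" and R: "\<And>w x. \<bar>R w x\<bar> \<le> 1"
    and one: "\<And>w x s s'. regular w \<Longrightarrow> norm (w - v) \<le> r \<Longrightarrow> 0 < s \<Longrightarrow> s \<le> s0 \<Longrightarrow> 0 \<le> s' \<Longrightarrow> s' \<le> s \<Longrightarrow> s - s' \<le> s\<^sup>2 \<Longrightarrow>
      (\<Sum>y\<in>UNIV. kern w x y * (lyap v (advance w s y) + s' * R (advance w s y) y))
        \<le> lyap v w + s * R w x - c * s * lyap v w + C * s\<^sup>2"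
    by (rule lyap_one_step[OF stable]) blast
  define s where "s = step_size TYPE('n)"
  have s_pos: "0 < s n" and s_diff: "s n - s (Suc n) = s n * s (Suc n)" and s_half: "s n / 2 \<le> s (Suc n)"
    and s_lim: "s \<longlonglongrightarrow> 0" for n
    unfolding s_def by (rule step_size_pos step_size_diff step_size_Suc_ge step_size_tendsto)+
  have s_mono: "s (Suc n) \<le> s n" for n
    using s_diff[of n] mult_pos_pos[OF s_pos[of n] s_pos[of "Suc n"]] by linarith
  \<comment> \<open>As a step size at most halves, \<open>2 * C\<close> turns the quadratic error
    \<open>C * (s n)\<^sup>2\<close> into a multiple of \<open>s n - s (Suc n)\<close>; the 1 makes
    \<open>D * s n\<close> dominate the correction, so that \<open>V\<close> stays below
    \<open>Y\<close>.\<close>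
  define D where "D = 2 * C + 1"
  define V where "V = (\<lambda>n h. lyap v (smooth_occ h n))"
  define Y where "Y = (\<lambda>n h. V n h + s n * R (smooth_occ h n) (h n) + D * s n)"
  \<comment> \<open>All weights are at least 1, so \<open>V\<close> below this level forces distance
    at most \<open>r\<close> from \<open>v\<close>.\<close>
  define \<epsilon> where "\<epsilon> = r\<^sup>2"
  have sR: "\<bar>s n * R w x\<bar> \<le> s n" for n w x
    using R[of w x] s_pos[of n] by (simp add: abs_mult mult_left_le)
  have D1: "s n \<le> D * s n" for n
    using pos s_pos[of n] by (simp add: D_def mult_le_cancel_right1)
  have w_dep: "depends_upto n (\<lambda>h. smooth_occ h n :: real^'n)" for n
    by (rule depends_uptoI) (rule smooth_occ_cong)
  have Vdep: "depends_upto n (V n)" for n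
    unfolding V_def by (rule depends_upto_comp[OF w_dep])
  have Ydep: "depends_upto n (Y n)" for n
  proof -
    have "depends_upto n (\<lambda>h. h n)" by (rule depends_uptoI) simp
    then have "depends_upto n (\<lambda>h. R (smooth_occ h n) (h n))" by (rule depends_upto_comp2[OF w_dep])
    then show ?thesis unfolding Y_def by (intro depends_intros Vdep)
  qed
  obtain h where h: "h 0 = x0" "\<And>n. A $ h n $ h (Suc n) \<noteq> 0" "(\<lambda>n. smooth_occ h n) \<longlonglongrightarrow> v"
    using exists_path_to_equilibrium[OF eq] by blast
  have "(\<lambda>n. V n h + (1 + D) * s n) \<longlonglongrightarrow> 0 + (1 + D) * 0"
    unfolding V_def by (intro tendsto_intros lyap_tendsto h(3) s_lim)
  then have "\<forall>\<^sub>F n in sequentially. V n h + (1 + D) * s n < \<epsilon>"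
    using pos by (intro order_tendstoD(2)) (auto simp: \<epsilon>_def)
  moreover have "\<forall>\<^sub>F n in sequentially. s n < s0" using s_lim pos by (intro order_tendstoD(2))
  ultimately have "\<forall>\<^sub>F n in sequentially. V n h + (1 + D) * s n < \<epsilon> \<and> s n < s0" by (rule eventually_conj)
  \<comment> \<open>At this time the path \<open>h\<close> is released: \<open>Y\<close> is below
    \<epsilon> there, and from then on the step sizes meet the one-step estimate.\<close>
  then obtain m where m: "\<And>n. m \<le> n \<Longrightarrow> V n h + (1 + D) * s n < \<epsilon> \<and> s n < s0"
    unfolding eventually_sequentially by blast
  interpret local_supermartingale M X "vrrw_trans A \<alpha>" Y V "\<lambda>n. c * s n" "\<lambda>n. (1 + D) * s n" m \<epsilon>
  proof
    show "depends_upto n (Y n)" "depends_upto n (V n)" for n by (rule Ydep, rule Vdep)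
    show "0 \<le> V n h" for n h
      using norm_le_lyap[OF eq, of "smooth_occ h n"] zero_le_power2 order_trans unfolding V_def by blast
    show "V n h \<le> Y n h" for n h using sR[of n] D1[of n] unfolding Y_def by (smt (verit))
    show "Y n h \<le> V n h + (1 + D) * s n" for n h
      using sR[of n "smooth_occ h n" "h n"] unfolding Y_def by (simp add: algebra_simps)
    show "(\<lambda>n. (1 + D) * s n) \<longlonglongrightarrow> 0" using tendsto_mult_left[OF s_lim, of "1 + D"] by simp
    show "0 \<le> c * s n" for n using pos s_pos[of n] by simp
    show "\<not> summable (\<lambda>n. c * s n)"
      using pos not_summable_step_size unfolding s_def by (simp add: summable_cmult_iff)
    show "0 < \<epsilon>" using pos by (simp add: \<epsilon>_def)
    show "(\<Sum>j\<in>UNIV. vrrw_trans A \<alpha> h n j * Y (Suc n) (h(Suc n := j))) \<le> Y n h - c * s n * V n h"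
      if "m \<le> n" "V n h < \<epsilon>" for n h
    proof -
      let ?w = "smooth_occ h n"
      have reg: "regular ?w" by (intro regular_pos smooth_occ_pos)
      have "(norm (?w - v))\<^sup>2 \<le> r\<^sup>2" using norm_le_lyap[OF eq, of ?w] that unfolding V_def \<epsilon>_def by linarith
      then have near: "norm (?w - v) \<le> r" using pos by (simp add: power2_le_iff_abs_le)
      have ss: "s n * s (Suc n) \<le> (s n)\<^sup>2"
        using s_mono[of n] s_pos[of n] by (simp add: power2_eq_square)
      have "(\<Sum>j\<in>UNIV. vrrw_trans A \<alpha> h n j * Y (Suc n) (h(Suc n := j))) =
        (\<Sum>y\<in>UNIV. kern ?w (h n) y * (lyap v (advance ?w (s n) y) + s (Suc n) * R (advance ?w (s n) y) y)
          + kern ?w (h n) y * (D * s (Suc n)))"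
        unfolding Y_def V_def vrrw_trans_kern smooth_occ_Suc s_def[symmetric]
        by (simp add: distrib_left)
      also have "\<dots> = (\<Sum>y\<in>UNIV. kern ?w (h n) y * (lyap v (advance ?w (s n) y) + s (Suc n) * R (advance ?w (s n) y) y))
          + D * s (Suc n)"
        unfolding sum.distrib by (simp add: sum_kern[OF reg] flip: sum_distrib_right)
      also have "\<dots> \<le> lyap v ?w + s n * R ?w (h n) - c * s n * lyap v ?w + C * (s n)\<^sup>2 + D * s (Suc n)"
        using m[OF that(1)] s_pos s_mono ss s_diff near reg less_imp_le[OF s_pos[of "Suc n"]]
        by (intro add_right_mono one) auto
      also have "C * (s n)\<^sup>2 \<le> D * (s n * s (Suc n))"
      proof -
        have "C * (s n)\<^sup>2 = 2 * C * (s n * (s n / 2))" by (simp add: power2_eq_square)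
        also have "\<dots> \<le> D * (s n * s (Suc n))"
          using s_half[of n] s_pos[of n] pos unfolding D_def by (intro mult_mono mult_left_mono) auto
        finally show ?thesis .
      qed
      finally show ?thesis unfolding Y_def V_def s_diff[symmetric] by (simp add: algebra_simps)
    qed
  qed
  have "0 < prob {\<omega>\<in>space M. (\<lambda>n. V n (path \<omega>)) \<longlonglongrightarrow> 0}"
  proof (rule convergence_positive[of h])
    show "0 < prob (cylinder m h)" unfolding cylinder_def by (rule cylinder_pos[OF vrrw h(1,2)])
    show "Y m h < \<epsilon>" using Y_le_V[of m h] m[of m] by simp
  qed
  also have "\<dots> \<le> prob {\<omega>\<in>space M. (\<lambda>n. occ X n \<omega>) \<longlonglongrightarrow> v}"
  proof (rule finite_measure_mono)
    show "{\<omega>\<in>space M. (\<lambda>n. V n (path \<omega>)) \<longlonglongrightarrow> 0} \<subseteq> {\<omega>\<in>space M. (\<lambda>n. occ X n \<omega>) \<longlonglongrightarrow> v}"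
    proof
      fix \<omega> assume \<omega>: "\<omega> \<in> {\<omega>\<in>space M. (\<lambda>n. V n (path \<omega>)) \<longlonglongrightarrow> 0}"
      then have "(\<lambda>n. lyap v (smooth_occ (\<lambda>k. X k \<omega>) n)) \<longlonglongrightarrow> 0" by (simp add: V_def path_def)
      then have "(\<lambda>n. smooth_occ (\<lambda>k. X k \<omega>) n) \<longlonglongrightarrow> v" by (rule lyap_tendsto_imp[OF eq])
      then have "(\<lambda>n. occ X n \<omega>) \<longlonglongrightarrow> v" by (rule smooth_occ_tendsto_imp_occ)
      with \<omega> show "\<omega> \<in> {\<omega>\<in>space M. (\<lambda>n. occ X n \<omega>) \<longlonglongrightarrow> v}" by simp
    qed
    have occ_meas: "(\<lambda>\<omega>. occ X n \<omega> $ i) \<in> borel_measurable M" for n i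
    proof -
      have "depends_upto n (\<lambda>h. real (visits h n i) / real (n + 1))"
        by (rule depends_upto_comp, rule depends_uptoI) (rule visits_cong)
      from borel_measurable_path[OF this] show ?thesis by (simp add: occ_def path_def)
    qed
    \<comment> \<open>Monotonicity of the measure needs the target event to be measurable; this is
      checked coordinatewise.\<close>
    have "{\<omega>\<in>space M. (\<lambda>n. occ X n \<omega>) \<longlonglongrightarrow> v} = {\<omega>\<in>space M. \<forall>i\<in>UNIV. (\<lambda>n. occ X n \<omega> $ i) \<longlonglongrightarrow> v $ i}"
      by (auto intro: vec_tendstoI tendsto_vec_nth)
    also have "\<dots> \<in> events"
    proof (intro sets.sets_Collect_finite_All)
      show "{\<omega>\<in>space M. (\<lambda>n. occ X n \<omega> $ i) \<longlonglongrightarrow> v $ i} \<in> events" for i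
        using measurable_limit2[of "\<lambda>n \<omega>. occ X n \<omega> $ i" M "\<lambda>_. v $ i"] occ_meas by (simp add: pred_def)
    qed simp
    finally show "{\<omega>\<in>space M. (\<lambda>n. occ X n \<omega>) \<longlonglongrightarrow> v} \<in> events" .
  qed
  finally show ?thesis .
qed

end

theorem theorem3p11:
  fixes A :: "real^'n^'n" and \<alpha> :: real and M :: "'w measure"
    and X :: "nat \<Rightarrow> 'w \<Rightarrow> 'n" and x0 :: 'n and vstar :: "real^'n"
  assumes "CARD('n) \<ge> 2"
    and "\<alpha> > 1"
    and "admissible_matrix A"
    and "is_vrrw M A \<alpha> x0 X"
    and "linearly_stable A \<alpha> vstar"
  shows "measure M {\<omega>\<in>space M. (\<lambda>n. occ X n \<omega>) \<longlonglongrightarrow> vstar} > 0"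
proof -
  interpret reinforcement A \<alpha> using assms(1-3) by unfold_locales
  show ?thesis by (rule vrrw_converges_with_positive_probability[OF assms(4,5)])
qed

end
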